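(* For each primitive vector $q\in\mathbb Z^n$ there exists a unique (up to a translation in $\mathbb Z^n$) periodic movable state on $\mathbb Z^n$ which is hyperplane-shaped of direction $q$. Furthermore, this state is $q$-movable.
   Context: $\mathbb Z^n$ is regarded as a graph: $z\sim z'$ (an edge) if and only if the Euclidean distance between $z,z'\in\mathbb Z^n$ is one. A vector $q\in\mathbb Z^n$ is primitive if there are no $k\in\mathbb Z$, $k>1$, and $q'\in\mathbb Z^n$ with $q=k\cdot q'$. A (sandpile) state is a function $\phi:\mathbb Z^n\to\mathbb Z_{\ge 0}$; $\phi(z)$ is thought of as the number of sand grains at $z$. A toppling at $z$ subtracts $2n$ grains from $z$ and adds one grain to each neighbour $z'\sim z$; it is legal if $\phi(z)\ge 2n$. A relaxation consists of doing legal topplings while it is possible; its result does not depend on the order of topplings. Wave: if $z\sim z'$ and $\phi(z)=\phi(z')=2n-1$, then sending a wave from $z$ means making a toppling at $z$ (after which $z$ temporarily has $-1$ grain), followed by the relaxation; the obtained state is denoted $W^z\phi$. For $v\in\mathbb Z^n\setminus\{0\}$, a state $\phi$ is called $v$-movable if there exists $z_0\in\mathbb Z^n$ such that $W^{z_0}\phi(z)=\phi(z+v)$ for all $z\in\mathbb Z^n$, and it is not true that $\phi(z)=\phi(z+v)$ for all $z$. A state is movable if it is $v$-movable for some $v\in\mathbb Z^n\setminus\{0\}$. For a rank $n-1$ sublattice $L$ of $\mathbb Z^n$, a state $\phi$ is $L$-periodic if $\phi(z)=\phi(z+p)$ for each $z\in\mathbb Z^n$, $p\in L$; it is periodic if it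 is $L$-periodic for some such $L$. For $q\in\mathbb Z^n\setminus\{0\}$, a state $\phi$ is hyperplane-shaped of direction $q$ if there exist constants $c_1,c_2$ such that the set $\{z : \phi(z)\ne 2n-1\}$ is contained in the set $\{z : c_1\le q\cdot z\le c_2\}$.
   Formalization: The last clause, that the state is q-movable, is false when q·q > 1 (for q = (1,1) a wave moves the state by one level of q·z, not by two); it is replaced by: the state is v-movable for every v with q·v = 1, which includes v = q when q·q = 1. *)

theory Defs
  imports "HOL-Analysis.Analysis"
begin

definition real_vec :: "int ^ 'n::finite \<Rightarrow> real ^ 'n" where
  "real_vec z = (\<chi> i. real_of_int (z $ i))"

definition adj :: "int ^ 'n::finite \<Rightarrow> int ^ 'n \<Rightarrow> bool" where
  "adj z z' \<longleftrightarrow> dist (real_vec z) (real_vec z') = 1"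

definition idot :: "int ^ 'n::finite \<Rightarrow> int ^ 'n \<Rightarrow> int" where
  "idot x y = (\<Sum>i\<in>UNIV. x $ i * y $ i)"

definition primitive_vec :: "int ^ 'n::finite \<Rightarrow> bool" where
  "primitive_vec q \<longleftrightarrow> \<not> (\<exists>(k::int) q'. k > 1 \<and> q = k *s q')"

text \<open>
  Configurations are integer-valued because the toppling that starts a wave leaves
  \<open>-1\<close> grains at its origin; a sandpile state proper is a nonnegative configuration.
\<close>

type_synonym 'n config = "int ^ 'n \<Rightarrow> int"

definition sand_state :: "'n::finite config \<Rightarrow> bool" where
  "sand_state \<phi> \<longleftrightarrow> (\<forall>z. \<phi> z \<ge> 0)"

definition topple :: "int ^ 'n::finite \<Rightarrow> 'n config \<Rightarrow> 'n config" where
  "topple z \<phi> = (\<lambda>w. if w = z then \<phi> w - 2 * int CARD('n)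
                     else if adj z w then \<phi> w + 1 else \<phi> w)"

text \<open>
  On an infinite lattice a relaxation may need infinitely many topplings.  We allow
  sequences of topplings indexed by the natural numbers (\<open>None\<close> is an idle step, so that
  finite sequences are included) and read off the result sitewise: the number of grains at
  every site must eventually be constant (equivalently, every site topples only finitely
  often), and no legal toppling may remain in the limit.
\<close>

primrec run :: "(nat \<Rightarrow> (int ^ 'n::finite) option) \<Rightarrow> 'n config \<Rightarrow> nat \<Rightarrow> 'n config" where
  "run s \<phi> 0 = \<phi>"
| "run s \<phi> (Suc k) =
     (case s k of None \<Rightarrow> run s \<phi> k | Some z \<Rightarrow> topple z (run s \<phi> k))"

definition legal_seq :: "(nat \<Rightarrow> (int ^ 'n::finite) option) \<Rightarrow> 'n config \<Rightarrow> bool" where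
  "legal_seq s \<phi> \<longleftrightarrow> (\<forall>k z. s k = Some z \<longrightarrow> run s \<phi> k z \<ge> 2 * int CARD('n))"

definition relaxes_to :: "'n::finite config \<Rightarrow> 'n config \<Rightarrow> bool" where
  "relaxes_to \<phi> \<psi> \<longleftrightarrow>
     (\<exists>s. legal_seq s \<phi> \<and> (\<forall>z. \<forall>\<^sub>F k in sequentially. run s \<phi> k z = \<psi> z)) \<and>
     (\<forall>z. \<psi> z < 2 * int CARD('n))"

text \<open>
  \<open>wave z \<phi> \<psi>\<close> says that a wave can be sent from \<open>z\<close>, and that the state
  obtained is \<open>\<psi>\<close>.
\<close>

definition wave :: "int ^ 'n::finite \<Rightarrow> 'n config \<Rightarrow> 'n config \<Rightarrow> bool" where
  "wave z \<phi> \<psi> \<longleftrightarrow>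
     (\<exists>z'. adj z z' \<and> \<phi> z = 2 * int CARD('n) - 1 \<and> \<phi> z' = 2 * int CARD('n) - 1) \<and>
     relaxes_to (topple z \<phi>) \<psi>"

definition movable_by :: "int ^ 'n::finite \<Rightarrow> 'n config \<Rightarrow> bool" where
  "movable_by v \<phi> \<longleftrightarrow>
     v \<noteq> 0 \<and> (\<exists>z0. wave z0 \<phi> (\<lambda>z. \<phi> (z + v))) \<and> \<not> (\<forall>z. \<phi> z = \<phi> (z + v))"

definition movable :: "'n::finite config \<Rightarrow> bool" where
  "movable \<phi> \<longleftrightarrow> (\<exists>v. movable_by v \<phi>)"

definition sublattice :: "(int ^ 'n::finite) set \<Rightarrow> bool" where
  "sublattice L \<longleftrightarrow> 0 \<in> L \<and> (\<forall>x\<in>L. \<forall>y\<in>L. x - y \<in> L)"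

text \<open>The rank of a subgroup of the integer lattice is the dimension of its real span.\<close>

definition lattice_rank :: "(int ^ 'n::finite) set \<Rightarrow> nat" where
  "lattice_rank L = dim (real_vec ` L)"

definition periodic_wrt :: "(int ^ 'n::finite) set \<Rightarrow> 'n config \<Rightarrow> bool" where
  "periodic_wrt L \<phi> \<longleftrightarrow> (\<forall>z. \<forall>p\<in>L. \<phi> z = \<phi> (z + p))"

definition periodic :: "'n::finite config \<Rightarrow> bool" where
  "periodic \<phi> \<longleftrightarrow>
     (\<exists>L. sublattice L \<and> lattice_rank L = CARD('n) - 1 \<and> periodic_wrt L \<phi>)"

definition hyperplane_shaped :: "int ^ 'n::finite \<Rightarrow> 'n config \<Rightarrow> bool" where
  "hyperplane_shaped q \<phi> \<longleftrightarrow>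
     (\<exists>c1 c2 :: real. {z. \<phi> z \<noteq> 2 * int CARD('n) - 1}
        \<subseteq> {z. c1 \<le> real_of_int (idot q z) \<and> real_of_int (idot q z) \<le> c2})"

definition soliton :: "int ^ 'n::finite \<Rightarrow> 'n config \<Rightarrow> bool" where
  "soliton q \<phi> \<longleftrightarrow> sand_state \<phi> \<and> periodic \<phi> \<and> movable \<phi> \<and> hyperplane_shaped q \<phi>"

text \<open>
  A wave topples each site at most once, and it shifts a soliton of direction \<open>q\<close> by
  exactly one level of \<open>z \<mapsto> q \<cdot> z\<close>.  It therefore realises the translations by
  the vectors \<open>v\<close> with \<open>q \<cdot> v = \<plusminus>1\<close>; the vector \<open>q\<close> itself is among them
  only if \<open>q \<cdot> q = 1\<close>.  For example, for \<open>n = 2\<close> and \<open>q = (1, 1)\<close> the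
  soliton has one grain on the line \<open>x + y = 0\<close> and three elsewhere; a wave moves that
  line to \<open>x + y = \<plusminus>1\<close>, and not to \<open>x + y = \<plusminus>2\<close>.  So the assertion that
  solitons of direction \<open>q\<close> move in the direction \<open>q\<close> has to be read as
  \<open>movable_by v\<close> for each \<open>v\<close> with \<open>idot q v = 1\<close> (such \<open>v\<close> exist for
  primitive \<open>q\<close>, and \<open>v = q\<close> is one of them when \<open>q \<cdot> q = 1\<close>).
\<close>

end

theory Submission
  imports Defs
begin

text \<open>
  Solitons are written as \<open>2n - 1 + lap \<theta>\<close> with \<open>\<theta>\<close> an integer superharmonic function equal to
  \<open>min 0 (q \<cdot> z)\<close> off a strip; a wave adds the indicator function of the toppled set to \<open>\<theta>\<close>, and
  it adds the least superharmonic increment that is positive at its origin.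

  Existence: there is a least such \<open>\<theta>\<close>.  It depends on \<open>q \<cdot> z\<close> only, so the question is about
  functions on the integers; these may be taken monotone with increments \<open>0\<close> and \<open>1\<close>.  On a long
  window where the function is harmonic, the increments are harmonic with extreme values, hence
  constant, and then the function is trivial on one side of the window.  As the total flux is
  bounded by \<open>q \<cdot> q\<close>, such windows occur in every interval of a fixed length; this confines the
  nontrivial part to a fixed interval.  Minimality forces the wave from far away to shift
  \<open>\<theta>\<close> by one level.

  Uniqueness: summing the waves of a soliton along \<open>v\<close> produces a potential \<open>F\<close>; periodicity makes it
  affine off the strip, which forces \<open>q \<cdot> v = \<plusminus>1\<close>.  The minimality of waves makes \<open>F\<close> the least
  solution of an obstacle problem at the origins of the successive waves.  This implies that \<open>F\<close> is
  invariant under \<open>\<plusminus>e - \<bar>q $ i\<bar> v\<close> for the unit vector \<open>e = axis i 1\<close>, hence that the wave may as well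
  start far away, where \<open>\<theta>\<close> solves the same obstacle problem.
\<close>

subsection \<open>The graph Laplacian on the integer lattice\<close>

definition lap :: "(int ^ 'n::finite \<Rightarrow> int) \<Rightarrow> int ^ 'n \<Rightarrow> int" where
  "lap f z = (\<Sum>i\<in>UNIV. f (z + axis i 1) + f (z - axis i 1) - 2 * f z)"

definition superharmonic :: "(int ^ 'n::finite \<Rightarrow> int) \<Rightarrow> bool" where
  "superharmonic f \<longleftrightarrow> (\<forall>z. lap f z \<le> 0)"

abbreviation ind :: "'a set \<Rightarrow> 'a \<Rightarrow> int" where
  "ind T z \<equiv> of_bool (z \<in> T)"

lemma idot_add: "idot q (x + y) = idot q x + idot q y"
  by (simp add: idot_def algebra_simps sum.distrib)

lemma idot_diff: "idot q (x - y) = idot q x - idot q y"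
  by (simp add: idot_def algebra_simps sum_subtractf)

lemma idot_scale: "idot q (k *s x) = k * idot q x"
  by (simp add: idot_def sum_distrib_left algebra_simps)

lemma idot_uminus: "idot q (- x) = - idot q x"
  by (simp add: idot_def sum_negf)

lemma idot_uminus_left: "idot (- q) x = - idot q x"
  by (simp add: idot_def sum_negf)

lemma idot_axis: "idot q (axis i k) = q $ i * k"
proof -
  have "idot q (axis i k) = (\<Sum>j\<in>UNIV. if j = i then q $ i * k else 0)"
    unfolding idot_def by (rule sum.cong) (auto simp: axis_def)
  thus ?thesis by simp
qed

lemmas idot_simps = idot_add idot_diff idot_scale idot_uminus idot_axis

lemma lap_add: "lap (\<lambda>z. f z + g z) z = lap f z + lap g z"
  by (simp add: lap_def sum.distrib sum_subtractf sum_distrib_left [symmetric] algebra_simps)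

lemma lap_diff: "lap (\<lambda>z. f z - g z) z = lap f z - lap g z"
  by (simp add: lap_def sum.distrib sum_subtractf sum_distrib_left [symmetric] algebra_simps)

lemma lap_minus: "lap (\<lambda>z. - f z) z = - lap f z"
  by (simp add: lap_def sum.distrib sum_subtractf sum_negf sum_distrib_left [symmetric])

lemma lap_cmult: "lap (\<lambda>z. c * f z) z = c * lap f z"
  by (simp add: lap_def sum_distrib_left algebra_simps)

lemma lap_const: "lap (\<lambda>z. c) z = 0"
  by (simp add: lap_def)

lemma lap_idot: "lap (idot q) z = 0"
  by (simp add: lap_def idot_simps)

lemma lap_shift: "lap (\<lambda>z. f (z + w)) z = lap f (z + w)"
  by (simp add: lap_def algebra_simps)

lemma lap_shift_diff: "lap (\<lambda>z. f (z - w)) z = lap f (z - w)"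
  by (simp add: lap_def algebra_simps)

lemma lap_mono_at:
  assumes "\<And>w. f w \<le> g w" "f z = g z"
  shows "lap f z \<le> lap g z"
  unfolding lap_def using assms by (intro sum_mono) (simp add: add_mono)

lemma lap_cong_near:
  assumes "f z = g z" "\<And>i. f (z + axis i 1) = g (z + axis i 1)" "\<And>i. f (z - axis i 1) = g (z - axis i 1)"
  shows "lap f z = lap g z"
  unfolding lap_def using assms by simp

lemma superharmonic_add_const: "superharmonic f \<Longrightarrow> superharmonic (\<lambda>z. f z + c)"
  unfolding superharmonic_def lap_add by (simp add: lap_const)

lemma superharmonic_shift: "superharmonic f \<Longrightarrow> superharmonic (\<lambda>z. f (z + w))"
  unfolding superharmonic_def by (simp add: lap_shift)

lemma superharmonic_shift_diff: "superharmonic f \<Longrightarrow> superharmonic (\<lambda>z. f (z - w))"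
  unfolding superharmonic_def by (simp add: lap_shift_diff)

lemma axis_uminus: "axis i (- (1::int)) = - axis i 1"
  by (simp add: vec_eq_iff axis_def)

lemma sum_axis_eq:
  fixes x :: "int ^ 'n::finite"
  shows "(\<Sum>i\<in>UNIV. if x = axis i 1 then 1 else (0::int)) = (if \<exists>i. x = axis i 1 then 1 else 0)"
proof (cases "\<exists>i. x = axis i 1")
  case True
  then obtain i where i: "x = axis i 1" by blast
  have "(\<Sum>j\<in>UNIV. if x = axis j 1 then 1 else (0::int)) = (\<Sum>j\<in>UNIV. if j = i then 1 else 0)"
    by (rule sum.cong) (auto simp: i axis_eq_axis)
  with True show ?thesis by simp
qed auto

lemma adj_iff:
  fixes z w :: "int ^ 'n::finite"
  shows "adj z w \<longleftrightarrow> (\<exists>i. w = z + axis i 1 \<or> w = z - axis i 1)"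
proof
  assume "adj z w"
  hence "norm (real_vec z - real_vec w) = 1" by (simp add: adj_def dist_norm)
  hence "(\<Sum>i\<in>UNIV. (real_of_int (z $ i) - real_of_int (w $ i))\<^sup>2) = 1"
    by (simp add: norm_vec_def L2_set_def real_vec_def)
  hence "real_of_int (\<Sum>i\<in>UNIV. (z $ i - w $ i)\<^sup>2) = 1" by simp
  hence s: "(\<Sum>i\<in>UNIV. (z $ i - w $ i)\<^sup>2) = 1" by linarith
  then obtain i where i: "z $ i - w $ i \<noteq> 0"
    by (metis (no_types, lifting) power_eq_0_iff sum.neutral zero_neq_numeral zero_neq_one zero_power2)
  have s2: "(z $ i - w $ i)\<^sup>2 + (\<Sum>j\<in>UNIV - {i}. (z $ j - w $ j)\<^sup>2) = 1"
    using s by (simp add: sum.remove [of UNIV i])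
  have nn: "(\<Sum>j\<in>UNIV - {i}. (z $ j - w $ j)\<^sup>2) \<ge> 0" by (rule sum_nonneg) simp
  have "(z $ i - w $ i)\<^sup>2 \<ge> 1" using i by (smt (verit) zero_less_power2)
  with s2 nn have e: "(z $ i - w $ i)\<^sup>2 = 1" and r: "(\<Sum>j\<in>UNIV - {i}. (z $ j - w $ j)\<^sup>2) = 0" by linarith+
  have "\<forall>j\<in>UNIV - {i}. (z $ j - w $ j)\<^sup>2 = 0"
    using r by (subst (asm) sum_nonneg_eq_0_iff) auto
  hence o: "w $ j = z $ j" if "j \<noteq> i" for j using that by auto
  from e have "w $ i = z $ i + 1 \<or> w $ i = z $ i - 1" by (auto simp: power2_eq_1_iff)
  thus "\<exists>i. w = z + axis i 1 \<or> w = z - axis i 1"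
  proof
    assume "w $ i = z $ i + 1"
    hence "w = z + axis i 1" by (auto simp: vec_eq_iff axis_def o)
    thus ?thesis by blast
  next
    assume "w $ i = z $ i - 1"
    hence "w = z - axis i 1" by (auto simp: vec_eq_iff axis_def o)
    thus ?thesis by blast
  qed
next
  assume "\<exists>i. w = z + axis i 1 \<or> w = z - axis i 1"
  then obtain i where i: "w = z + axis i 1 \<or> w = z - axis i 1" by blast
  have "real_vec z - real_vec w = axis i 1 \<or> real_vec z - real_vec w = - axis i 1"
    using i by (auto simp: vec_eq_iff real_vec_def axis_def)
  hence "norm (real_vec z - real_vec w) = 1" by auto
  thus "adj z w" by (simp add: adj_def dist_norm)
qed

text \<open>Makes topplings additive: a state reached by topplings is the initial one plus the
  Laplacian of the toppling counts.\<close>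

lemma topple_eq: "topple z \<phi> w = \<phi> w + lap (ind {z}) w"
proof -
  let ?x = "w - z"
  have nz: "axis i (1::int) \<noteq> 0" for i :: 'a by (simp add: axis_eq_0_iff)
  have pm: "axis i (1::int) \<noteq> - axis j 1" for i j :: 'a
    by (metis axis_uminus axis_eq_axis zero_neq_one one_neq_neg_one)
  have "lap (ind {z}) w = (\<Sum>i\<in>UNIV. (if - ?x = axis i 1 then 1 else 0) + (if ?x = axis i 1 then 1 else 0)
      - 2 * (if w = z then 1 else 0))"
    unfolding lap_def by (rule sum.cong) (auto simp: algebra_simps)
  also have "\<dots> = (\<Sum>i\<in>UNIV. if - ?x = axis i 1 then 1 else 0) + (\<Sum>i\<in>UNIV. if ?x = axis i 1 then 1 else 0)
      - 2 * int CARD('a) * (if w = z then 1 else 0)"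
    by (simp add: sum.distrib sum_subtractf)
  also have "\<dots> = (if \<exists>i. - ?x = axis i 1 then 1 else 0) + (if \<exists>i. ?x = axis i 1 then 1 else 0)
      - 2 * int CARD('a) * (if w = z then 1 else 0)"
    by (simp only: sum_axis_eq)
  finally have l: "lap (ind {z}) w = \<dots>" .
  have a: "adj z w \<longleftrightarrow> (\<exists>i. - ?x = axis i 1) \<or> (\<exists>i. ?x = axis i 1)"
  proof -
    have "w = z + axis i 1 \<longleftrightarrow> ?x = axis i 1" "w = z - axis i 1 \<longleftrightarrow> - ?x = axis i 1" for i
      by (auto simp: algebra_simps)
    thus ?thesis unfolding adj_iff by auto
  qed
  have b: "\<not> ((\<exists>i. - ?x = axis i 1) \<and> (\<exists>i. ?x = axis i 1))" 
  proof
    assume "(\<exists>i. - ?x = axis i 1) \<and> (\<exists>i. ?x = axis i 1)"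
    then obtain i j where "- ?x = axis i 1" "?x = axis j 1" by blast
    hence "axis i (1::int) = - axis j 1" by simp
    thus False using pm by blast
  qed
  show ?thesis
  proof (cases "w = z")
    case True
    hence "?x = 0" by simp
    hence "\<not> (\<exists>i. - ?x = axis i 1)" "\<not> (\<exists>i. ?x = axis i 1)" using nz by (metis neg_0_equal_iff_equal)+
    thus ?thesis unfolding topple_def l using True by simp
  next
    case False
    show ?thesis
      unfolding topple_def l using False a b by auto
  qed
qed

section \<open>Lattice walks and minimum principles\<close>

lemma step_induct:
  fixes x z :: "int ^ 'n::finite"
  assumes "P z"
    and "\<And>y i. 0 < x $ i \<Longrightarrow> P y \<Longrightarrow> P (y + axis i 1)"
    and "\<And>y i. x $ i < 0 \<Longrightarrow> P y \<Longrightarrow> P (y - axis i 1)"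
  shows "P (z + x)"
  using assms
proof (induction "\<Sum>i\<in>UNIV. nat \<bar>x $ i\<bar>" arbitrary: x z rule: less_induct)
  case less
  show ?case
  proof (cases "x = 0")
    case True
    thus ?thesis using less.prems by simp
  next
    case False
    then obtain i where i: "x $ i \<noteq> 0" by (auto simp: vec_eq_iff)
    \<comment> \<open>A unit step towards the target shortens the displacement and flips no sign, so
      the sign conditions on the steps survive the recursion.\<close>
    define s where "s = axis i (sgn (x $ i))"
    have "P (z + s)"
    proof (cases "x $ i > 0")
      case True
      thus ?thesis using less.prems(2)[OF True less.prems(1)] by (simp add: s_def)
    next
      case False
      with i have "x $ i < 0" by simp
      thus ?thesis using less.prems(3)[OF _ less.prems(1)] by (simp add: s_def axis_uminus)
    qed
    have sn: "(x - s) $ j = (if j = i then x $ i - sgn (x $ i) else x $ j)" for j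
      by (simp add: s_def axis_def)
    have dec: "(\<Sum>j\<in>UNIV. nat \<bar>(x - s) $ j\<bar>) < (\<Sum>j\<in>UNIV. nat \<bar>x $ j\<bar>)"
    proof (rule sum_strict_mono_ex1)
      show "\<forall>j\<in>UNIV. nat \<bar>(x - s) $ j\<bar> \<le> nat \<bar>x $ j\<bar>" unfolding sn by (auto simp: sgn_if)
      show "\<exists>j\<in>UNIV. nat \<bar>(x - s) $ j\<bar> < nat \<bar>x $ j\<bar>" unfolding sn using i
        by (intro bexI[of _ i]) (auto simp: sgn_if)
    qed simp
    have sg: "0 < (x - s) $ j \<Longrightarrow> 0 < x $ j" "(x - s) $ j < 0 \<Longrightarrow> x $ j < 0" for j
      unfolding sn by (auto simp: sgn_if split: if_splits)
    have "P ((z + s) + (x - s))"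
    proof (rule less.hyps[OF dec \<open>P (z + s)\<close>])
      show "P (y + axis i 1)" if "0 < (x - s) $ i" "P y" for y i
        by (rule less.prems(2)[OF sg(1)[OF that(1)] that(2)])
      show "P (y - axis i 1)" if "(x - s) $ i < 0" "P y" for y i
        by (rule less.prems(3)[OF sg(2)[OF that(1)] that(2)])
    qed
    thus ?thesis by simp
  qed
qed

lemma lattice_induct:
  fixes z w :: "int ^ 'n::finite"
  assumes "P z" "\<And>y i. P y \<Longrightarrow> P (y + axis i 1)" "\<And>y i. P y \<Longrightarrow> P (y - axis i 1)"
  shows "P w"
  using step_induct [of P z "w - z"] assms by simp

text \<open>At a minimum all summands of the Laplacian are nonnegative, so a nonpositive sum makes
  each of them vanish. The inequality is asked for at the single site \<open>z\<close>, since
  uniqueness applies this to functions controlled at one site only.\<close>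

lemma superharmonic_min_step:
  assumes "lap F z \<le> 0" "\<And>w. \<mu> \<le> F w" "F z = \<mu>"
  shows "F (z + axis i 1) = \<mu>" "F (z - axis i 1) = \<mu>"
proof -
  let ?t = "\<lambda>i. F (z + axis i 1) + F (z - axis i 1) - 2 * F z"
  have nn: "?t i \<ge> 0" for i
    using assms(2)[of "z + axis i 1"] assms(2)[of "z - axis i 1"] assms(3) by linarith
  have "sum ?t UNIV = 0" using assms(1) sum_nonneg[of UNIV ?t] nn unfolding lap_def by fastforce
  hence "?t i = 0" using sum_nonneg_eq_0_iff[of UNIV ?t] nn by simp
  thus "F (z + axis i 1) = \<mu>" "F (z - axis i 1) = \<mu>"
    using assms(2)[of "z + axis i 1"] assms(2)[of "z - axis i 1"] assms(3) by linarith+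
qed

lemma minimum_principle:
  assumes "superharmonic F" "\<And>w. \<mu> \<le> F w" "F z = \<mu>"
  shows "F w = \<mu>"
proof (rule lattice_induct [of "\<lambda>w. F w = \<mu>" z])
  show "F (y + axis i 1) = \<mu>" "F (y - axis i 1) = \<mu>" if "F y = \<mu>" for y i
    using superharmonic_min_step[of F y \<mu>] assms that by (auto simp: superharmonic_def)
qed (fact assms)

lemma int_bdd_below_attains:
  fixes f :: "'a \<Rightarrow> int"
  assumes "x \<in> A" "\<And>y. y \<in> A \<Longrightarrow> K \<le> f y"
  shows "\<exists>x\<in>A. \<forall>y\<in>A. f x \<le> f y"
proof -
  obtain a where "a \<in> A" "\<forall>y. y \<in> A \<longrightarrow> nat (f a - K) \<le> nat (f y - K)"
    using ex_has_least_nat[of "\<lambda>x. x \<in> A" x "\<lambda>x. nat (f x - K)"] assms(1) by blast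
  thus ?thesis using assms(2) by (intro bexI[of _ a]) (auto simp: nat_le_eq_zle)
qed

text \<open>Integrality is what makes this true in every dimension: a lower bound suffices for the
  minimum to be attained, and then the minimum spreads to all sites.\<close>

lemma superharmonic_bdd_below_const:
  assumes "superharmonic F" "\<And>w. K \<le> F w"
  shows "F w = F z"
proof -
  have "\<exists>x\<in>UNIV. \<forall>y\<in>UNIV. F x \<le> F y"
    by (rule int_bdd_below_attains[of z _ K]) (simp_all add: assms(2))
  then obtain x where x: "\<And>y. F x \<le> F y" by blast
  have "F u = F x" for u using minimum_principle[OF assms(1) x refl] .
  thus ?thesis by metis
qed

text \<open>Moving down along coordinates with nonzero \<open>q $ i\<close> and freely along the others joins
  any two points of a half-space.\<close>

lemma halfspace_connected:
  fixes q :: "int ^ 'n::finite"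
  assumes "idot q z \<le> c" "idot q w \<le> c"
    and "\<And>y i. idot q y \<le> c \<Longrightarrow> idot q (y + axis i 1) \<le> c \<Longrightarrow> P y \<longleftrightarrow> P (y + axis i 1)"
  shows "P z \<longleftrightarrow> P w"
proof -
  define u where "u = (\<chi> i. if q $ i > 0 then min (z $ i) (w $ i)
    else if q $ i < 0 then max (z $ i) (w $ i) else z $ i)"
  have *: "P y \<longleftrightarrow> P u" if y: "idot q y \<le> c" and x: "\<And>i. 0 < (u - y) $ i \<Longrightarrow> q $ i \<le> 0" 
      "\<And>i. (u - y) $ i < 0 \<Longrightarrow> q $ i \<ge> 0" for y
  proof -
    have "idot q (y + (u - y)) \<le> c \<and> (P y \<longleftrightarrow> P (y + (u - y)))"
    proof (rule step_induct [where P = "\<lambda>x. idot q x \<le> c \<and> (P y \<longleftrightarrow> P x)"])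
      show "idot q y \<le> c \<and> P y = P y" using y by simp
    next
      fix p i assume "0 < (u - y) $ i" and p: "idot q p \<le> c \<and> P y = P p"
      hence "idot q (p + axis i 1) \<le> c" using x(1) by (fastforce simp: idot_simps)
      thus "idot q (p + axis i 1) \<le> c \<and> P y = P (p + axis i 1)" using assms(3) p by blast
    next
      fix p i assume "(u - y) $ i < 0" and p: "idot q p \<le> c \<and> P y = P p"
      hence "idot q (p - axis i 1) \<le> c" using x(2) by (fastforce simp: idot_simps)
      thus "idot q (p - axis i 1) \<le> c \<and> P y = P (p - axis i 1)"
        using assms(3)[of "p - axis i 1" i] p by simp
    qed
    thus ?thesis by simp
  qed
  have "P z \<longleftrightarrow> P u" by (rule *) (use assms in \<open>auto simp: u_def split: if_splits\<close>)
  moreover have "P w \<longleftrightarrow> P u" by (rule *) (use assms in \<open>auto simp: u_def split: if_splits\<close>)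
  ultimately show ?thesis by simp
qed

subsection \<open>Relaxations and waves\<close>

lemma lap_ind_insert:
  assumes "y \<notin> R"
  shows "lap (ind (insert y R)) z = lap (ind R) z + lap (ind {y}) z"
proof -
  have "ind (insert y R) = (\<lambda>z. ind R z + ind {y} z)" using assms by (auto simp: fun_eq_iff)
  thus ?thesis by (simp only: lap_add)
qed

lemma lap_ind_nonneg: "z \<notin> R \<Longrightarrow> lap (ind R) z \<ge> 0"
  unfolding lap_def by (rule sum_nonneg) auto

lemma lap_ind_nonpos: "z \<in> R \<Longrightarrow> lap (ind R) z \<le> 0"
  unfolding lap_def by (rule sum_nonpos) auto

lemma lap_ind_pos: "z \<notin> R \<Longrightarrow> adj z w \<Longrightarrow> w \<in> R \<Longrightarrow> lap (ind R) z > 0"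
proof -
  assume *: "z \<notin> R" "adj z w" "w \<in> R"
  then obtain i where i: "w = z + axis i 1 \<or> w = z - axis i 1" by (auto simp: adj_iff)
  show ?thesis unfolding lap_def
    by (rule sum_pos2[of _ i]) (use * i in auto)
qed

text \<open>Least action principle: by induction along the legal topplings, no site topples more
  often than a stabilizing competitor \<open>u\<close> with \<open>1 \<le> u z0\<close> prescribes.
  The constant \<open>1\<close> is such a competitor, so each site topples at most once and the wave
  is described by a set \<open>T\<close>.\<close>

lemma wave_least:
  fixes \<psi> \<psi>' :: "'n::finite config"
  assumes "relaxes_to (topple z0 \<psi>) \<psi>'" and stable: "\<And>z. \<psi> z < 2 * int CARD('n)"
  obtains T where "z0 \<in> T" "\<forall>z. \<psi>' z = \<psi> z + lap (ind T) z"
    "\<forall>u. (\<forall>z. 0 \<le> u z) \<longrightarrow> 1 \<le> u z0 \<longrightarrow> (\<forall>z. \<psi> z + lap u z < 2 * int CARD('n))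
      \<longrightarrow> (\<forall>z. ind T z \<le> u z)"
proof -
  obtain s where s: "legal_seq s (topple z0 \<psi>)"
    and lim: "\<And>z. \<forall>\<^sub>F k in sequentially. run s (topple z0 \<psi>) k z = \<psi>' z"
    using assms(1) by (auto simp: relaxes_to_def)
  \<comment> \<open>The toppling counts after \<open>k\<close> steps; the toppling at
    \<open>z0\<close> that starts the wave is counted from the outset.\<close>
  define c where "c = rec_nat (ind {z0}) (\<lambda>k f z. f z + of_bool (s k = Some z))"
  have c0: "c 0 = ind {z0}" and cS: "c (Suc k) = (\<lambda>z. c k z + of_bool (s k = Some z))" for k
    by (simp_all add: c_def)
  have run: "run s (topple z0 \<psi>) k z = \<psi> z + lap (c k) z" for k z
  proof (induction k arbitrary: z)
    case 0
    show ?case by (simp add: topple_eq c0)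
  next
    case (Suc k)
    show ?case
    proof (cases "s k")
      case None
      thus ?thesis by (simp add: Suc cS)
    next
      case (Some y)
      have "c (Suc k) = (\<lambda>z. c k z + ind {y} z)" by (auto simp: cS Some fun_eq_iff)
      hence "lap (c (Suc k)) z = lap (c k) z + lap (ind {y}) z" by (simp only: lap_add)
      thus ?thesis by (simp only: run.simps Some option.case topple_eq[of y] Suc)
    qed
  qed
  have least: "c k z \<le> u z"
    if u: "\<And>z. 0 \<le> u z" "1 \<le> u z0" "\<And>z. \<psi> z + lap u z < 2 * int CARD('n)" for u k z
  proof (induction k arbitrary: z)
    case 0
    show ?case using u by (simp add: c0)
  next
    case (Suc k)
    show ?case
    proof (cases "s k = Some z \<and> c k z = u z")
      \<comment> \<open>If \<open>z\<close> topples when the counts already agree with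
        \<open>u\<close> there, then \<open>lap (c k) z \<le> lap u z\<close>, so \<open>u\<close>
        would leave \<open>z\<close> unstable.\<close>
      case True
      hence "2 * int CARD('n) \<le> \<psi> z + lap (c k) z"
        using s by (auto simp: legal_seq_def run [symmetric])
      moreover have "lap (c k) z \<le> lap u z" using True Suc by (intro lap_mono_at) auto
      ultimately show ?thesis using u(3)[of z] by linarith
    next
      case False
      thus ?thesis using Suc[of z] by (auto simp: cS)
    qed
  qed
  have le1: "c k z \<le> 1" for k z
    using least[of "\<lambda>_. 1"] stable by (simp add: lap_const)
  have ge0: "0 \<le> c k z" for k z
    by (induction k arbitrary: z) (auto simp: c0 cS)
  have mono: "c k z \<le> c (k + m) z" for k m z
    by (induction m) (auto simp: cS)
  define T where "T = {z. \<exists>k. c k z = 1}"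
  have ev: "\<exists>k0. \<forall>k\<ge>k0. c k z = ind T z" for z
  proof (cases "z \<in> T")
    case True
    then obtain k0 where "c k0 z = 1" by (auto simp: T_def)
    hence "c k z = 1" if "k \<ge> k0" for k
      using mono[of k0 z "k - k0"] le1[of k z] that by simp
    thus ?thesis using True by auto
  next
    case False
    hence "c k z \<noteq> 1" for k by (auto simp: T_def)
    hence "c k z = 0" for k using ge0[of k z] le1[of k z] by (smt (verit))
    thus ?thesis using False by auto
  qed
  then obtain K where K: "\<And>z k. k \<ge> K z \<Longrightarrow> c k z = ind T z" by metis
  show ?thesis
  proof
    show "z0 \<in> T" unfolding T_def mem_Collect_eq by (rule exI[of _ 0]) (simp add: c0)
  next
    show "\<forall>z. \<psi>' z = \<psi> z + lap (ind T) z"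
    proof
      fix z :: "int ^ 'n"
      let ?N = "insert z (range (\<lambda>i. z + axis i 1) \<union> range (\<lambda>i. z - axis i 1))"
      obtain k1 where k1: "\<And>k. k \<ge> k1 \<Longrightarrow> run s (topple z0 \<psi>) k z = \<psi>' z"
        using lim[of z] by (auto simp: eventually_sequentially)
      define k where "k = max k1 (Max (K ` ?N))"
      have kN: "c k w = ind T w" if "w \<in> ?N" for w
      proof (rule K)
        have "K w \<le> Max (K ` ?N)" by (rule Max_ge[OF _ imageI[OF that]]) simp
        thus "K w \<le> k" unfolding k_def by (rule order_trans [OF _ max.cobounded2])
      qed
      have "lap (c k) z = lap (ind T) z" by (rule lap_cong_near) (intro kN; simp)+
      moreover have "run s (topple z0 \<psi>) k z = \<psi>' z" by (rule k1) (simp add: k_def)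
      ultimately show "\<psi>' z = \<psi> z + lap (ind T) z" using run by metis
    qed
  next
    show "\<forall>u. (\<forall>z. 0 \<le> u z) \<longrightarrow> 1 \<le> u z0 \<longrightarrow> (\<forall>z. \<psi> z + lap u z < 2 * int CARD('n))
      \<longrightarrow> (\<forall>z. ind T z \<le> u z)"
    proof (intro allI impI)
      fix u z assume u: "\<forall>z. 0 \<le> u z" "1 \<le> u z0" "\<forall>z. \<psi> z + lap u z < 2 * int CARD('n)"
      have "c (K z) z \<le> u z" by (rule least) (use u in auto)
      thus "ind T z \<le> u z" using K[of z "K z"] by simp
    qed
  qed
qed

text \<open>The relaxation visits every site infinitely often and topples it as soon as this is legal.\<close>

lemma wave_exists:
  fixes \<psi> :: "'n::finite config"
  assumes stable: "\<And>z. \<psi> z < 2 * int CARD('n)"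
  obtains R where "relaxes_to (topple z0 \<psi>) (\<lambda>z. \<psi> z + lap (ind R) z)"
proof -
  define e :: "nat \<Rightarrow> int ^ 'n" where "e k = from_nat (fst (prod_decode k))" for k
  \<comment> \<open>Only sites outside \<open>R\<close> may topple. Nothing is lost: at a toppled
    site the Laplacian of the indicator is nonpositive, so the site stays stable.\<close>
  define ok where "ok R k \<longleftrightarrow> e k \<notin> R \<and> \<psi> (e k) + lap (ind R) (e k) \<ge> 2 * int CARD('n)" for R k
  define Rs where "Rs = rec_nat {z0} (\<lambda>k R. if ok R k then insert (e k) R else R)"
  have R0: "Rs 0 = {z0}" and RS: "Rs (Suc k) = (if ok (Rs k) k then insert (e k) (Rs k) else Rs k)" for k
    by (simp_all add: Rs_def)
  define s where "s k = (if ok (Rs k) k then Some (e k) else None)" for k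
  have run: "run s (topple z0 \<psi>) k z = \<psi> z + lap (ind (Rs k)) z" for k z
  proof (induction k arbitrary: z)
    case 0
    show ?case by (simp add: topple_eq R0)
  next
    case (Suc k)
    show ?case
    proof (cases "ok (Rs k) k")
      case True
      hence "e k \<notin> Rs k" by (simp add: ok_def)
      hence "lap (ind (Rs (Suc k))) z = lap (ind (Rs k)) z + lap (ind {e k}) z"
        unfolding RS if_P[OF True] by (rule lap_ind_insert)
      moreover have "s k = Some (e k)" using True by (simp add: s_def)
      ultimately show ?thesis by (simp only: run.simps option.case topple_eq[of "e k"] Suc)
    next
      case False
      hence "s k = None" "Rs (Suc k) = Rs k" by (simp_all add: s_def RS)
      thus ?thesis by (simp only: run.simps option.case Suc)
    qed
  qed
  have "legal_seq s (topple z0 \<psi>)"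
    unfolding legal_seq_def run by (auto simp: s_def ok_def split: if_splits)
  have mono: "Rs k \<subseteq> Rs (k + m)" for k m
    by (induction m) (auto simp: RS)
  define R where "R = (\<Union>k. Rs k)"
  have ev: "\<exists>k0. \<forall>k\<ge>k0. z \<in> Rs k \<longleftrightarrow> z \<in> R" for z
  proof (cases "z \<in> R")
    case True
    then obtain k0 where "z \<in> Rs k0" by (auto simp: R_def)
    hence "z \<in> Rs k" if "k \<ge> k0" for k using mono[of k0 "k - k0"] that by auto
    thus ?thesis using True by auto
  qed (auto simp: R_def)
  then obtain K where K: "\<And>z k. k \<ge> K z \<Longrightarrow> z \<in> Rs k \<longleftrightarrow> z \<in> R" by metis
  have lapev: "\<exists>k0. \<forall>k\<ge>k0. lap (ind (Rs k)) z = lap (ind R) z" for z :: "int ^ 'n"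
  proof -
    let ?N = "insert z (range (\<lambda>i. z + axis i 1) \<union> range (\<lambda>i. z - axis i 1))"
    have kN: "w \<in> Rs k \<longleftrightarrow> w \<in> R" if "w \<in> ?N" "k \<ge> Max (K ` ?N)" for w k
    proof (rule K)
      have "K w \<le> Max (K ` ?N)" by (rule Max_ge[OF _ imageI[OF that(1)]]) simp
      thus "K w \<le> k" using that(2) by linarith
    qed
    have "lap (ind (Rs k)) z = lap (ind R) z" if "k \<ge> Max (K ` ?N)" for k
      by (rule lap_cong_near; subst kN[OF _ that]; simp)
    thus ?thesis by blast
  qed
  have st: "\<psi> z + lap (ind R) z < 2 * int CARD('n)" for z
  proof (cases "z \<in> R")
    case True
    show ?thesis using lap_ind_nonpos[OF True] stable[of z] by linarith
  next
    case False
    show ?thesis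
    proof (rule ccontr)
      assume a: "\<not> ?thesis"
      obtain k0 where k0: "\<And>k. k \<ge> k0 \<Longrightarrow> lap (ind (Rs k)) z = lap (ind R) z" using lapev by blast
      \<comment> \<open>A visit to \<open>z\<close> not before \<open>k0\<close>; a site outside
        \<open>R\<close> that is unstable in the limit would topple now.\<close>
      define k where "k = prod_encode (to_nat z, k0)"
      have "k \<ge> k0" by (simp add: k_def le_prod_encode_2)
      have "e k = z" by (simp add: e_def k_def)
      hence "ok (Rs k) k" using a False k0[OF \<open>k \<ge> k0\<close>] by (auto simp: ok_def R_def)
      hence "z \<in> Rs (Suc k)" using \<open>e k = z\<close> by (simp add: RS)
      thus False using False by (auto simp: R_def)
    qed
  qed
  show ?thesis
  proof
    have "\<forall>\<^sub>F k in sequentially. run s (topple z0 \<psi>) k z = \<psi> z + lap (ind R) z" for z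
      using lapev[of z] unfolding run eventually_sequentially by auto
    thus "relaxes_to (topple z0 \<psi>) (\<lambda>z. \<psi> z + lap (ind R) z)"
      unfolding relaxes_to_def using \<open>legal_seq s (topple z0 \<psi>)\<close> st by auto
  qed
qed

text \<open>A wave crosses from a full site to a full neighbour, so it topples all or none of a
  full half-space.\<close>

lemma wave_all_or_none:
  fixes \<psi> :: "'n::finite config" and q :: "int ^ 'n"
  assumes stable: "\<And>z. \<psi> z + lap (ind T) z < 2 * int CARD('n)"
    and full: "\<And>z. idot q z \<le> c \<Longrightarrow> \<psi> z = 2 * int CARD('n) - 1"
    and "idot q z \<le> c" "idot q w \<le> c"
  shows "z \<in> T \<longleftrightarrow> w \<in> T"
proof (rule halfspace_connected[OF assms(3,4)])
  fix y i assume y: "idot q y \<le> c" "idot q (y + axis i 1) \<le> c"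
  have a: "adj y (y + axis i 1)" "adj (y + axis i 1) y" by (auto simp: adj_iff intro!: exI[of _ i])
  show "y \<in> T \<longleftrightarrow> y + axis i 1 \<in> T"
    using lap_ind_pos[OF _ a(1), of T] lap_ind_pos[OF _ a(2), of T] full[OF y(1)] full[OF y(2)]
      stable[of y] stable[of "y + axis i 1"] by fastforce
qed

subsection \<open>The least profile\<close>

definition lap1 :: "int ^ 'n::finite \<Rightarrow> (int \<Rightarrow> int) \<Rightarrow> int \<Rightarrow> int" where
  "lap1 q g t = (\<Sum>i\<in>UNIV. g (t + q $ i) + g (t - q $ i) - 2 * g t)"

lemma lap_level: "lap (\<lambda>z. g (idot q z)) z = lap1 q g (idot q z)"
  by (simp add: lap_def lap1_def idot_simps)

lemma lap1_cong:
  assumes "g t = h t" "\<And>i. g (t + q $ i) = h (t + q $ i)" "\<And>i. g (t - q $ i) = h (t - q $ i)"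
  shows "lap1 q g t = lap1 q h t"
  unfolding lap1_def using assms by simp

lemma lap1_mono_at:
  assumes "\<And>s. g s \<le> h s" "g t = h t"
  shows "lap1 q g t \<le> lap1 q h t"
  unfolding lap1_def using assms by (intro sum_mono) (simp add: add_mono)

lemma lap1_shift: "lap1 q (\<lambda>t. g (t + c)) t = lap1 q g (t + c)"
  unfolding lap1_def by (rule sum.cong) (simp_all add: algebra_simps)

lemma lap1_add_const: "lap1 q (\<lambda>t. g t + c) t = lap1 q g t"
  unfolding lap1_def by (rule sum.cong) simp_all

lemma lap1_diff: "lap1 q (\<lambda>t. g t - h t) t = lap1 q g t - lap1 q h t"
  unfolding lap1_def sum_subtractf [symmetric] by (rule sum.cong) simp_all

text \<open>The least positive element \<open>d\<close> of the subgroup divides every coordinate of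
  \<open>q\<close>, so primitivity gives \<open>d = 1\<close>. The subgroup is arbitrary because it
  will be the set of values of \<open>idot q\<close> and also a group of approximate
  periods.\<close>

lemma primitive_subgroup:
  assumes q: "primitive_vec q" and S: "0 \<in> S" "\<And>x y. x \<in> S \<Longrightarrow> y \<in> S \<Longrightarrow> x - y \<in> S" "\<And>i. q $ i \<in> S"
  shows "(1::int) \<in> S"
proof -
  have neg: "- x \<in> S" if "x \<in> S" for x using S(2)[OF S(1) that] by simp
  have add: "x + y \<in> S" if "x \<in> S" "y \<in> S" for x y using S(2)[OF that(1) neg[OF that(2)]] by simp
  have mul: "int n * x \<in> S" if "x \<in> S" for n x
    by (induction n) (use add that S(1) in \<open>auto simp: algebra_simps\<close>)
  have mulz: "k * x \<in> S" if "x \<in> S" for k x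
    using mul[OF that, of "nat \<bar>k\<bar>"] neg[OF mul[OF that, of "nat \<bar>k\<bar>"]] by (cases "k \<ge> 0") auto
  have "q \<noteq> 0"
  proof
    assume "q = 0"
    hence "q = 2 *s 0" by simp
    thus False using q unfolding primitive_vec_def by (metis one_less_numeral_iff semiring_norm(76))
  qed
  then obtain i where "q $ i \<noteq> 0" by (auto simp: vec_eq_iff)
  hence "\<bar>q $ i\<bar> \<in> {x\<in>S. x > 0}" using S(3)[of i] neg by (auto simp: abs_if)
  then obtain d where d: "d \<in> {x\<in>S. x > 0}" "\<And>x. x \<in> {x\<in>S. x > 0} \<Longrightarrow> d \<le> x"
    using int_bdd_below_attains[of "\<bar>q $ i\<bar>" "{x\<in>S. x > 0}" 0 "\<lambda>x. x"] by (metis (mono_tags, lifting) less_imp_le mem_Collect_eq)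
  have "d dvd x" if "x \<in> S" for x
  proof -
    have "x mod d = x - (x div d) * d" by (simp add: minus_div_mult_eq_mod)
    hence "x mod d \<in> S" using S(2)[OF that mulz[of d "x div d"]] d(1) by simp
    moreover have "0 \<le> x mod d" "x mod d < d" using d(1) by auto
    ultimately show ?thesis using d(2)[of "x mod d"] by (cases "x mod d = 0") (auto simp: dvd_eq_mod_eq_0)
  qed
  hence "q = d *s (\<chi> j. q $ j div d)" using S(3) by (simp add: vec_eq_iff)
  hence "\<not> d > 1" using q unfolding primitive_vec_def by blast
  with d(1) show ?thesis by (metis (mono_tags, lifting) int_one_le_iff_zero_less mem_Collect_eq order_less_le)
qed

lemma primitive_idot:
  assumes "primitive_vec q"
  obtains v where "\<And>t. idot q (t *s v) = t"
proof -
  have one: "1 \<in> range (idot q)"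
  proof (rule primitive_subgroup[OF assms])
    show "0 \<in> range (idot q)" by (rule range_eqI[of _ _ 0]) (simp add: idot_def)
    show "x - y \<in> range (idot q)" if "x \<in> range (idot q)" "y \<in> range (idot q)" for x y
      using that by (auto simp: idot_diff [symmetric])
    show "q $ i \<in> range (idot q)" for i by (rule range_eqI[of _ _ "axis i 1"]) (simp add: idot_axis)
  qed
  obtain v where "idot q v = 1" using one by (rule rangeE) metis
  hence "idot q (t *s v) = t" for t by (simp add: idot_scale)
  thus ?thesis using that by blast
qed

lemma primitive_nonzero: "primitive_vec q \<Longrightarrow> q \<noteq> 0"
proof
  assume q: "primitive_vec q" "q = 0"
  obtain v where v: "\<And>t. idot q (t *s v) = t" using primitive_idot[OF q(1)] by blast
  show False using v[of 1] by (simp add: idot_def q(2))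
qed

lemma lap1_minimum_principle:
  assumes "primitive_vec q" "\<And>t. lap1 q g t \<le> 0" "\<And>t. \<mu> \<le> g t" "g s = \<mu>"
  shows "g t = \<mu>"
proof -
  obtain v where v: "\<And>t. idot q (t *s v) = t" using primitive_idot assms(1) by blast
  have "superharmonic (\<lambda>z. g (idot q z))" using assms(2) by (simp add: superharmonic_def lap_level)
  hence "g (idot q (t *s v)) = \<mu>" by (rule minimum_principle[of _ _ "s *s v"]) (use assms v in auto)
  thus ?thesis by (simp add: v)
qed

section \<open>Profiles and a uniform bound on their nontrivial part\<close>

definition profile :: "int ^ 'n::finite \<Rightarrow> (int \<Rightarrow> int) \<Rightarrow> bool" where
  "profile q g \<longleftrightarrow> (\<forall>t. lap1 q g t \<le> 0) \<and> (\<exists>C. \<forall>t. C \<le> \<bar>t\<bar> \<longrightarrow> g t = min 0 t)"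

definition unit_slopes :: "(int \<Rightarrow> int) \<Rightarrow> bool" where
  "unit_slopes g \<longleftrightarrow> (\<forall>t. g t \<le> g (t + 1) \<and> g (t + 1) \<le> g t + 1)"

lemma unit_slopes_mono:
  assumes "unit_slopes g" "s \<le> t" shows "g s \<le> g t" "g t \<le> g s + (t - s)"
proof -
  have "g s \<le> g (s + int n) \<and> g (s + int n) \<le> g s + int n" for n
  proof (induction n)
    case (Suc n)
    thus ?case using assms(1)[unfolded unit_slopes_def, rule_format, of "s + int n"]
      by (simp add: algebra_simps)
  qed simp
  from this[of "nat (t - s)"] show "g s \<le> g t" "g t \<le> g s + (t - s)" using assms(2) by auto
qed

text \<open>Where \<open>g\<close> is harmonic its increments are harmonic with the extreme values \<open>0\<close> and \<open>1\<close>,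
  so they are constant along each step \<open>\<plusminus>q $ i\<close>, hence constant.\<close>

lemma increments_constant:
  assumes q: "primitive_vec q"
  obtains B where "B \<ge> 0"
    "\<And>g l h t. \<lbrakk>unit_slopes g; \<And>t. l \<le> t \<Longrightarrow> t \<le> h \<Longrightarrow> lap1 q g t = 0; l + B \<le> t; t \<le> h - B\<rbrakk>
      \<Longrightarrow> g (t + 2) - g (t + 1) = g (t + 1) - g t"
proof -
  define inv where "inv d l h \<longleftrightarrow> (\<forall>t i. l \<le> t \<longrightarrow> t \<le> h \<longrightarrow> d (t + q $ i) = d t \<and> d (t - q $ i) = d t)"
    for d :: "int \<Rightarrow> int" and l h
  \<comment> \<open>The approximate periods: shifts preserving every invariant \<open>d\<close> away
    from the ends of the interval, with a margin \<open>B\<close> that depends on the shift only.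
    They form a subgroup containing all \<open>q $ i\<close>, hence \<open>1\<close>.\<close>
  define S where "S = {s. \<exists>B\<ge>0. \<forall>d l h t. inv d l h \<longrightarrow> l + B \<le> t \<longrightarrow> t \<le> h - B \<longrightarrow> d (t + s) = d t}"
  have "1 \<in> S"
  proof (rule primitive_subgroup[OF q])
    show "0 \<in> S" by (auto simp: S_def intro!: exI[of _ 0])
    show "q $ i \<in> S" for i by (auto simp: S_def inv_def intro!: exI[of _ 0])
    fix x y assume "x \<in> S" "y \<in> S"
    then obtain A B where A: "A \<ge> 0" "\<And>d l h t. inv d l h \<Longrightarrow> l + A \<le> t \<Longrightarrow> t \<le> h - A \<Longrightarrow> d (t + x) = d t"
      and B: "B \<ge> 0" "\<And>d l h t. inv d l h \<Longrightarrow> l + B \<le> t \<Longrightarrow> t \<le> h - B \<Longrightarrow> d (t + y) = d t"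
      unfolding S_def by blast
    have "d (t + (x - y)) = d t"
      if "inv d l h" "l + (A + B + \<bar>x\<bar> + \<bar>y\<bar>) \<le> t" "t \<le> h - (A + B + \<bar>x\<bar> + \<bar>y\<bar>)" for d l h t
    proof -
      have "d (t + x - y + y) = d (t + x - y)" by (rule B(2)[OF that(1)]) (use that A(1) B(1) in linarith)+
      moreover have "d (t + x) = d t" by (rule A(2)[OF that(1)]) (use that A(1) B(1) in linarith)+
      ultimately show ?thesis by (simp add: algebra_simps)
    qed
    thus "x - y \<in> S" using A(1) B(1) unfolding S_def by (intro CollectI exI[of _ "A + B + \<bar>x\<bar> + \<bar>y\<bar>"]) auto
  qed
  then obtain B where B: "B \<ge> 0" "\<And>d l h t. inv d l h \<Longrightarrow> l + B \<le> t \<Longrightarrow> t \<le> h - B \<Longrightarrow> d (t + 1) = d t"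
    unfolding S_def by blast
  show ?thesis
  proof (rule that[of "B + 1"])
    fix g l h t
    assume g: "unit_slopes g" and harm: "\<And>t. l \<le> t \<Longrightarrow> t \<le> h \<Longrightarrow> lap1 q g t = 0"
      and t: "l + (B + 1) \<le> t" "t \<le> h - (B + 1)"
    define d where "d t = g (t + 1) - g t" for t
    have d01: "0 \<le> d t" "d t \<le> 1" for t
      using g[unfolded unit_slopes_def, rule_format, of t] by (auto simp: d_def)
    have "inv d l (h - 1)" unfolding inv_def
    proof (intro allI impI)
      fix s i assume s: "l \<le> s" "s \<le> h - 1"
      have l0: "lap1 q d s = 0"
        using harm[of s] harm[of "s + 1"] s unfolding d_def lap1_diff lap1_shift by simp
      let ?t = "\<lambda>i. d (s + q $ i) + d (s - q $ i) - 2 * d s"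
      have "?t i = 0"
      proof (cases "d s = 0")
        case True
        hence "\<And>j. ?t j \<ge> 0" using d01 by (simp add: add_nonneg_nonneg)
        thus ?thesis using l0 sum_nonneg_eq_0_iff[of UNIV ?t] by (simp add: lap1_def)
      next
        case False
        hence "d s = 1" using d01[of s] by linarith
        have "?t j \<le> 0" for j using d01(2)[of "s + q $ j"] d01(2)[of "s - q $ j"] \<open>d s = 1\<close> by linarith
        thus ?thesis using l0 sum_nonneg_eq_0_iff[of UNIV "\<lambda>i. - ?t i"]
          by (simp add: lap1_def sum_negf del: minus_diff_eq)
      qed
      thus "d (s + q $ i) = d s \<and> d (s - q $ i) = d s"
        using d01[of s] d01[of "s + q $ i"] d01[of "s - q $ i"] by linarith
    qed
    hence "d (t + 1) = d t" by (rule B(2)) (use t in linarith)+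
    thus "g (t + 2) - g (t + 1) = g (t + 1) - g t" by (simp add: d_def algebra_simps)
  qed (use B(1) in simp)
qed

text \<open>Replacing \<open>g\<close> by the constant \<open>g s\<close> to the left of
  \<open>s\<close> keeps it superharmonic, since the window is so wide that every stencil stays
  either in the flat part or to the right of \<open>s\<close>. The result attains its minimum, hence
  is constant, and far to the right it is \<open>0\<close>.\<close>

lemma flat_window_right:
  assumes q: "primitive_vec q" and g: "profile q g" "unit_slopes g"
    and a: "\<And>i. \<bar>q $ i\<bar> \<le> a"
    and flat: "\<And>t. s \<le> t \<Longrightarrow> t \<le> s + 2 * a \<Longrightarrow> g t = g s" and "s \<le> t"
  shows "g t = 0"
proof -
  have sh: "lap1 q g t \<le> 0" for t using g(1) by (simp add: profile_def)
  obtain C where C: "\<And>t. C \<le> \<bar>t\<bar> \<Longrightarrow> g t = min 0 t" using g(1) by (auto simp: profile_def)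
  define h where "h t = (if t \<le> s then g s else g t)" for t
  have a': "q $ i \<le> a" "- (q $ i) \<le> a" for i using a[of i] by linarith+
  have a0: "0 \<le> a" using a by (metis abs_ge_zero order_trans)
  have mono: "g s \<le> g t" if "s \<le> t" for t using unit_slopes_mono[OF g(2) that] by simp
  have hs: "h t = g s" if "t \<le> s + 2 * a" for t using flat[of t] that by (auto simp: h_def)
  have hge: "h t = g t" if "s \<le> t" for t using that by (auto simp: h_def)
  have "lap1 q h t \<le> 0" for t
  proof (cases "t \<le> s + a")
    case True
    have "lap1 q h t = lap1 q (\<lambda>_. g s) t"
    proof (rule lap1_cong; rule hs)
      show "t \<le> s + 2 * a" "t + q $ i \<le> s + 2 * a" "t - q $ i \<le> s + 2 * a" for i
        using True a0 a'[of i] by linarith+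
    qed
    thus ?thesis by (simp add: lap1_def)
  next
    case False
    have "lap1 q h t = lap1 q g t"
    proof (rule lap1_cong; rule hge)
      show "s \<le> t" "s \<le> t + q $ i" "s \<le> t - q $ i" for i using False a0 a'[of i] by linarith+
    qed
    thus ?thesis using sh by simp
  qed
  moreover have "g s \<le> h t" for t using mono by (simp add: h_def)
  ultimately have c: "h t = g s" for t using lap1_minimum_principle[OF q, of h "g s" s] by (simp add: h_def)
  have "h (max s \<bar>C\<bar>) = 0" using C[of "max s \<bar>C\<bar>"] by (simp add: hge)
  with c have "g s = 0" by metis
  thus ?thesis using c[of t] hge[OF \<open>s \<le> t\<close>] by simp
qed

text \<open>The map \<open>g \<mapsto> (\<lambda>t. g (- t) + t)\<close> exchanges the two sides of
  a profile and the increments \<open>0\<close> and \<open>1\<close>, because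
  \<open>min 0 (- t) + t = min 0 t\<close>.\<close>

lemma lap1_reflect: "lap1 q (\<lambda>t. g (- t) + t) t = lap1 q g (- t)"
  unfolding lap1_def by (rule sum.cong) (simp_all add: algebra_simps)

lemma profile_reflect: "profile q g \<Longrightarrow> profile q (\<lambda>t. g (- t) + t)"
  unfolding profile_def lap1_reflect by (metis abs_minus_cancel add.commute add.right_neutral add_0 min_def minus_add_cancel neg_le_0_iff_le linorder_linear order_antisym)

lemma unit_slopes_reflect: "unit_slopes g \<Longrightarrow> unit_slopes (\<lambda>t. g (- t) + t)"
  unfolding unit_slopes_def
proof
  fix t assume "\<forall>t. g t \<le> g (t + 1) \<and> g (t + 1) \<le> g t + 1"
  from this[rule_format, of "- t - 1"]
  show "g (- t) + t \<le> g (- (t + 1)) + (t + 1) \<and> g (- (t + 1)) + (t + 1) \<le> g (- t) + t + 1" by simp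
qed

lemma steep_window_left:
  assumes q: "primitive_vec q" and g: "profile q g" "unit_slopes g"
    and a: "\<And>i. \<bar>q $ i\<bar> \<le> a"
    and steep: "\<And>t. s - 2 * a \<le> t \<Longrightarrow> t \<le> s \<Longrightarrow> g t = g s + (t - s)" and "t \<le> s"
  shows "g t = t"
proof -
  have "g (- (- t)) + (- t) = 0"
  proof (rule flat_window_right[OF q profile_reflect[OF g(1)] unit_slopes_reflect[OF g(2)] a])
    show "g (- t) + t = g (- (- s)) + (- s)" if "- s \<le> t" "t \<le> - s + 2 * a" for t
      using steep[of "- t"] that by simp
  qed (use \<open>t \<le> s\<close> in auto)
  thus ?thesis by simp
qed

text \<open>The flux through the bond between \<open>t\<close> and \<open>t + 1\<close> is monotone and bounded in terms of \<open>q\<close>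
  alone, so every long interval contains a window without flux change.\<close>

lemma harmonic_window:
  fixes q :: "int ^ 'n::finite"
  obtains M where "M \<ge> 0"
    "\<And>g x N. \<lbrakk>profile q g; unit_slopes g; N \<ge> 0\<rbrakk>
      \<Longrightarrow> \<exists>y. x \<le> y \<and> y \<le> x + M * N \<and> (\<forall>t. y < t \<longrightarrow> t \<le> y + N \<longrightarrow> lap1 q g t = 0)"
proof -
  define M where "M = (\<Sum>i\<in>UNIV. \<bar>q $ i\<bar> * \<bar>q $ i\<bar>)"
  have M0: "M \<ge> 0" by (auto simp: M_def intro!: sum_nonneg)
  show ?thesis
  proof (rule that[OF M0])
    fix g x N assume g: "profile q g" "unit_slopes g" and N: "N \<ge> (0::int)"
    define f where "f i s = g s - g (s - \<bar>q $ i\<bar>)" for i s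
    \<comment> \<open>The edges of direction \<open>i\<close> that cross the bond from
      \<open>t\<close> to \<open>t + 1\<close> have right ends
      \<open>t + 1, ..., t + \<bar>q $ i\<bar>\<close>. Summing the differences of \<open>g\<close>
      along them gives the flux, whose increment telescopes to \<open>lap1 q g t\<close>.\<close>
    define \<Phi> where "\<Phi> t = (\<Sum>i\<in>UNIV. \<Sum>j<nat \<bar>q $ i\<bar>. f i (t + 1 + int j))" for t
    have f01: "0 \<le> f i s" "f i s \<le> \<bar>q $ i\<bar>" for i s
      using unit_slopes_mono[OF g(2), of "s - \<bar>q $ i\<bar>" s] by (auto simp: f_def)
    have \<Phi>0: "0 \<le> \<Phi> t" for t unfolding \<Phi>_def by (intro sum_nonneg f01)
    have \<Phi>M: "\<Phi> t \<le> M" for t unfolding \<Phi>_def M_def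
    proof (rule sum_mono)
      fix i
      have "(\<Sum>j<nat \<bar>q $ i\<bar>. f i (t + 1 + int j)) \<le> (\<Sum>j<nat \<bar>q $ i\<bar>. \<bar>q $ i\<bar>)"
        by (intro sum_mono f01)
      thus "(\<Sum>j<nat \<bar>q $ i\<bar>. f i (t + 1 + int j)) \<le> \<bar>q $ i\<bar> * \<bar>q $ i\<bar>" by simp
    qed
    have diff: "\<Phi> t - \<Phi> (t - 1) = lap1 q g t" for t
      unfolding \<Phi>_def lap1_def sum_subtractf [symmetric]
    proof (rule sum.cong[OF refl])
      fix i
      have "(\<Sum>j<nat \<bar>q $ i\<bar>. f i (t + 1 + int j) - f i (t - 1 + 1 + int j))
          = (\<Sum>j<nat \<bar>q $ i\<bar>. f i (t + int (Suc j)) - f i (t + int j))"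
        by (rule sum.cong) (simp_all add: algebra_simps)
      also have "\<dots> = f i (t + \<bar>q $ i\<bar>) - f i t"
        by (subst sum_lessThan_telescope[where f = "\<lambda>j. f i (t + int j)"]) simp
      also have "\<dots> = g (t + q $ i) + g (t - q $ i) - 2 * g t"
        by (cases "q $ i \<ge> 0") (simp_all add: f_def)
      finally show "(\<Sum>j<nat \<bar>q $ i\<bar>. f i (t + 1 + int j) - f i (t - 1 + 1 + int j))
          = g (t + q $ i) + g (t - q $ i) - 2 * g t" .
    qed
    have step: "\<Phi> t \<le> \<Phi> (t - 1)" for t 
    proof -
      have "lap1 q g t \<le> 0" using g(1) by (simp add: profile_def)
      thus ?thesis using diff[of t] by linarith
    qed
    have anti: "\<Phi> (t + int n) \<le> \<Phi> t" for t n
    proof (induction n)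
      case (Suc n)
      thus ?case using step[of "t + int (Suc n)"] by (simp add: algebra_simps)
    qed simp
    \<comment> \<open>Among \<open>M + 1\<close> consecutive windows of length \<open>N\<close> one
      has no flux drop: each drop costs at least \<open>1\<close>, and the flux stays between
      \<open>0\<close> and \<open>M\<close>.\<close>
    have "\<exists>k\<le>nat M. \<Phi> (x + int k * N) = \<Phi> (x + int k * N + N)"
    proof (rule ccontr)
      assume a: "\<not> ?thesis"
      have "\<Phi> (x + int k * N) \<le> M - int k" if "k \<le> nat M + 1" for k
        using that
      proof (induction k)
        case 0
        show ?case using \<Phi>M by simp
      next
        case (Suc k)
        have "\<Phi> (x + int k * N + N) \<noteq> \<Phi> (x + int k * N)" using a Suc.prems by force
        moreover have "\<Phi> (x + int k * N + N) \<le> \<Phi> (x + int k * N)"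
          using anti[of "x + int k * N" "nat N"] N by simp
        ultimately show ?case using Suc by (simp add: algebra_simps)
      qed
      from this[of "nat M + 1"] \<Phi>0[of "x + int (nat M + 1) * N"] M0 show False by simp
    qed
    then obtain k where k: "k \<le> nat M" "\<Phi> (x + int k * N) = \<Phi> (x + int k * N + N)" by blast
    define y where "y = x + int k * N"
    have "lap1 q g t = 0" if t: "y < t" "t \<le> y + N" for t
      using anti[of y "nat (t - 1 - y)"] anti[of t "nat (y + N - t)"] k(2) step[of t] diff[of t] t
      unfolding y_def [symmetric] by simp
    moreover have "int k * N \<le> M * N" using k(1) M0 N by (intro mult_right_mono) auto
    ultimately show "\<exists>y. x \<le> y \<and> y \<le> x + M * N \<and> (\<forall>t. y < t \<longrightarrow> t \<le> y + N \<longrightarrow> lap1 q g t = 0)"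
      using N by (intro exI[of _ y]) (auto simp: y_def)
  qed
qed

text \<open>Inside a harmonic window the increment is constantly \<open>0\<close> or
  \<open>1\<close>, which makes \<open>g\<close> trivial to the right or to the left of it. The
  bound is independent of \<open>g\<close>, so that a pointwise minimum of such profiles is trivial
  off the same strip.\<close>

lemma profile_uniform_bound:
  fixes q :: "int ^ 'n::finite"
  assumes q: "primitive_vec q"
  obtains C where "C \<ge> 0" "\<And>g t. \<lbrakk>profile q g; unit_slopes g; C \<le> \<bar>t\<bar>\<rbrakk> \<Longrightarrow> g t = min 0 t"
proof -
  obtain B where B: "B \<ge> 0"
    "\<And>g l h t. \<lbrakk>unit_slopes g; \<And>t. l \<le> t \<Longrightarrow> t \<le> h \<Longrightarrow> lap1 q g t = 0; l + B \<le> t; t \<le> h - B\<rbrakk>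
      \<Longrightarrow> g (t + 2) - g (t + 1) = g (t + 1) - g t"
    using increments_constant[OF q] by blast
  obtain M where M: "M \<ge> 0" "\<And>g x N. \<lbrakk>profile q g; unit_slopes g; N \<ge> 0\<rbrakk>
      \<Longrightarrow> \<exists>y. x \<le> y \<and> y \<le> x + M * N \<and> (\<forall>t. y < t \<longrightarrow> t \<le> y + N \<longrightarrow> lap1 q g t = 0)"
    using harmonic_window[of q] by blast
  define a where "a = (\<Sum>i\<in>UNIV. \<bar>q $ i\<bar>)"
  have a: "\<bar>q $ i\<bar> \<le> a" for i unfolding a_def by (rule member_le_sum) auto
  have a0: "a \<ge> 0" unfolding a_def by (rule sum_nonneg) auto
  \<comment> \<open>Long enough to leave, after a margin \<open>B\<close> at both ends, a linear
    stretch of length \<open>2 * a\<close> as the window lemmas require; \<open>D\<close> bounds how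
    far to the right of \<open>x\<close> that stretch begins.\<close>
  define N where "N = 2 * B + 2 * a + 3"
  define D where "D = M * N + 1 + B"
  have N0: "N \<ge> 0" using B(1) a0 by (simp add: N_def)
  have D0: "D \<ge> 0" using M(1) N0 B(1) by (simp add: D_def)
  have dich: "(\<forall>t\<ge>x + D. g t = 0) \<or> (\<forall>t\<le>x. g t = t)" if g: "profile q g" "unit_slopes g" for g x
  proof -
    obtain y where y: "x \<le> y" "y \<le> x + M * N" "\<And>t. y < t \<Longrightarrow> t \<le> y + N \<Longrightarrow> lap1 q g t = 0"
      using M(2)[OF g N0] by blast
    define s where "s = y + 1 + B"
    define d where "d = g (s + 1) - g s"
    have dd: "g (s + int k + 1) - g (s + int k) = d" if "int k \<le> 2 * a" for k
      using that
    proof (induction k)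
      case (Suc k)
      have "g (s + int k + 2) - g (s + int k + 1) = g (s + int k + 1) - g (s + int k)"
      proof (rule B(2)[OF g(2), of "y + 1" "y + N"])
        show "lap1 q g t = 0" if "y + 1 \<le> t" "t \<le> y + N" for t using y(3) that by simp
      qed (use Suc.prems B(1) in \<open>simp_all add: s_def N_def\<close>)
      thus ?case using Suc by (simp add: algebra_simps)
    qed (simp add: d_def)
    have lin: "g (s + int k) = g s + int k * d" if "int k \<le> 2 * a" for k
      using that
    proof (induction k)
      case (Suc k)
      thus ?case using dd[of k] by (simp add: algebra_simps)
    qed simp
    have lin': "g t = g s + (t - s) * d" if "s \<le> t" "t \<le> s + 2 * a" for t
      using lin[of "nat (t - s)"] that by simp
    have "d = 0 \<or> d = 1" using g(2)[unfolded unit_slopes_def, rule_format, of s] by (auto simp: d_def)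
    thus ?thesis
    proof
      assume "d = 0"
      hence "g t = g s" if "s \<le> t" "t \<le> s + 2 * a" for t using lin'[OF that] by simp
      hence "g t = 0" if "s \<le> t" for t by (rule flat_window_right[OF q g a _ that])
      moreover have "s \<le> x + D" using y(2) by (simp add: s_def D_def)
      ultimately show ?thesis by simp
    next
      assume "d = 1"
      define r where "r = s + 2 * a"
      have "g t = g r + (t - r)" if "r - 2 * a \<le> t" "t \<le> r" for t
        using lin'[of t] lin'[of r] a0 that unfolding \<open>d = 1\<close> r_def by simp
      hence "g t = t" if "t \<le> s + 2 * a" for t
        using that unfolding r_def [symmetric] by (rule steep_window_left[OF q g a])
      moreover have "x \<le> s + 2 * a" using y(1) B(1) a0 by (simp add: s_def)
      ultimately show ?thesis by simp
    qed
  qed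
  show ?thesis
  proof (rule that[of "D + 1"])
    fix g t assume g: "profile q g" "unit_slopes g" and t: "D + 1 \<le> \<bar>t\<bar>"
    obtain C where C: "\<And>t. C \<le> \<bar>t\<bar> \<Longrightarrow> g t = min 0 t" using g(1) by (auto simp: profile_def)
    \<comment> \<open>The values at \<open>1\<close> and \<open>- 1\<close> decide the dichotomy:
      \<open>g 1 \<le> 0\<close> excludes \<open>g t = t\<close> up to \<open>1\<close>, and
      \<open>g (- 1) \<noteq> 0\<close> excludes \<open>g t = 0\<close> from \<open>- 1\<close>
      on.\<close>
    have "g 1 \<le> g (\<bar>C\<bar> + 1)" by (rule unit_slopes_mono[OF g(2)]) simp
    hence "g 1 \<le> 0" using C[of "\<bar>C\<bar> + 1"] by simp
    hence right: "g t = 0" if "t \<ge> D + 1" for t using dich[OF g, of 1] that by fastforce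
    have "g (- 1) \<le> g (- \<bar>C\<bar> - 1) + (- 1 - (- \<bar>C\<bar> - 1))" by (rule unit_slopes_mono[OF g(2)]) simp
    hence "g (- 1) \<noteq> 0" using C[of "- \<bar>C\<bar> - 1"] by simp
    hence "g t = t" if "t \<le> - D - 1" for t using dich[OF g, of "- D - 1"] that by fastforce
    with right t show "g t = min 0 t" by (cases "t \<ge> 0") auto
  qed (use D0 in simp)
qed

section \<open>Minima of families of profiles\<close>

lemma pointwise_min:
  fixes A :: "('a \<Rightarrow> int) set"
  assumes "A \<noteq> {}" "\<And>t. \<exists>K. \<forall>g\<in>A. K \<le> g t"
  obtains h where "\<And>t. \<exists>g\<in>A. h t = g t" "\<And>g t. g \<in> A \<Longrightarrow> h t \<le> g t"
proof -
  have "\<exists>g\<in>A. \<forall>k\<in>A. g t \<le> k t" for t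
  proof -
    obtain K where "\<forall>g\<in>A. K \<le> g t" using assms(2) by blast
    moreover obtain g where "g \<in> A" using assms(1) by blast
    ultimately show ?thesis by (intro int_bdd_below_attains[of g A K "\<lambda>g. g t"]) auto
  qed
  then obtain G where G: "\<And>t. G t \<in> A" "\<And>t k. k \<in> A \<Longrightarrow> G t t \<le> k t" by metis
  show ?thesis by (rule that[of "\<lambda>t. G t t"]) (use G in auto)
qed

lemma lap1_pointwise_min:
  assumes "\<And>t. \<exists>g\<in>A. h t = g t" "\<And>g t. g \<in> A \<Longrightarrow> h t \<le> g t" "\<And>g t. g \<in> A \<Longrightarrow> lap1 q g t \<le> 0"
  shows "lap1 q h t \<le> 0"
proof -
  obtain g where g: "g \<in> A" "h t = g t" using assms(1) by blast
  have "lap1 q h t \<le> lap1 q g t" by (rule lap1_mono_at) (use g assms(2) in auto)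
  thus ?thesis using assms(3)[OF g(1), of t] by simp
qed

lemma profile_lower_bound:
  assumes "profile q g"
  obtains C where "C \<ge> 0" "\<And>t. C \<le> \<bar>t\<bar> \<Longrightarrow> g t = min 0 t" "\<And>t. min 0 t - C \<le> g t"
proof -
  obtain C where C: "\<And>t. C \<le> \<bar>t\<bar> \<Longrightarrow> g t = min 0 t" using assms by (auto simp: profile_def)
  obtain x where x: "\<forall>t\<in>{- \<bar>C\<bar>..\<bar>C\<bar>}. g x \<le> g t"
  proof -
    have "\<exists>x\<in>{- \<bar>C\<bar>..\<bar>C\<bar>}. \<forall>t\<in>{- \<bar>C\<bar>..\<bar>C\<bar>}. g x \<le> g t"
      by (rule int_bdd_below_attains[of 0 _ "Min (g ` {- \<bar>C\<bar>..\<bar>C\<bar>})"]) (auto intro!: Min_le)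
    thus ?thesis using that by blast
  qed
  show ?thesis
  proof (rule that[of "\<bar>C\<bar> + \<bar>g x\<bar>"])
    show "min 0 t - (\<bar>C\<bar> + \<bar>g x\<bar>) \<le> g t" for t
    proof (cases "\<bar>C\<bar> \<le> \<bar>t\<bar>")
      case True
      thus ?thesis using C[of t] by linarith
    next
      case False
      hence "t \<in> {- \<bar>C\<bar>..\<bar>C\<bar>}" by auto
      hence "g x \<le> g t" using x by blast
      thus ?thesis by linarith
    qed
  qed (use C in auto)
qed

text \<open>An infimal convolution: reading \<open>g\<close> further right is free, reading it
  further left costs the distance. This cost forces increments \<open>0\<close> and
  \<open>1\<close>, and superharmonicity survives translation and minimum.\<close>

lemma profile_regularize:
  assumes g: "profile q g"
  obtains h where "profile q h" "unit_slopes h" "\<And>t. h t \<le> g t"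
proof -
  obtain C where C: "C \<ge> 0" "\<And>t. C \<le> \<bar>t\<bar> \<Longrightarrow> g t = min 0 t" "\<And>t. min 0 t - C \<le> g t"
    using profile_lower_bound[OF g] by blast
  define A where "A = range (\<lambda>j t. g (t + j) + max 0 (- j))"
  have lb: "min 0 t - C \<le> g (t + j) + max 0 (- j)" for t j using C(3)[of "t + j"] by linarith
  have "A \<noteq> {}" by (simp add: A_def)
  moreover have "\<exists>K. \<forall>k\<in>A. K \<le> k t" for t using lb by (auto simp: A_def intro!: exI[of _ "min 0 t - C"])
  ultimately obtain h where h: "\<And>t. \<exists>k\<in>A. h t = k t" "\<And>k t. k \<in> A \<Longrightarrow> h t \<le> k t"
    by (rule pointwise_min) blast
  have hex: "\<exists>j. h t = g (t + j) + max 0 (- j)" for t using h(1)[of t] by (auto simp: A_def)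
  have hle: "h t \<le> g (t + j) + max 0 (- j)" for t j
    using h(2)[of "\<lambda>t. g (t + j) + max 0 (- j)" t] by (auto simp: A_def)
  have sh: "lap1 q h t \<le> 0" for t
  proof (rule lap1_pointwise_min [of A h])
    show "\<exists>k\<in>A. h t = k t" for t by (rule h(1))
    show "h t \<le> k t" if "k \<in> A" for k t using that by (rule h(2))
  next
    fix k t assume "k \<in> A"
    then obtain j where "k = (\<lambda>t. g (t + j) + max 0 (- j))" by (auto simp: A_def)
    thus "lap1 q k t \<le> 0" using g by (simp add: lap1_add_const lap1_shift profile_def)
  qed
  have hg: "h t \<le> g t" for t using hle[of t 0] by simp
  \<comment> \<open>If the minimum reads \<open>g\<close> in its irregular zone, then for
    \<open>t > 0\<close> the cost exceeds \<open>2 * C\<close> and outweighs the dip of at most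
    \<open>2 * C\<close>, while for \<open>t < 0\<close> the dip is not below
    \<open>t\<close>.\<close>
  have asy: "h t = min 0 t" if t: "3 * C \<le> \<bar>t\<bar>" for t
  proof -
    obtain j where j: "h t = g (t + j) + max 0 (- j)" using hex by blast
    have "min 0 t \<le> h t"
    proof (cases "C \<le> \<bar>t + j\<bar>")
      case True
      thus ?thesis using j C(2)[of "t + j"] by linarith
    next
      case False
      thus ?thesis using j C(1) C(3)[of "t + j"] t by linarith
    qed
    thus ?thesis using hg[of t] C(1) C(2)[of t] t by linarith
  qed
  have "unit_slopes h" unfolding unit_slopes_def
  proof
    fix t
    obtain j where j: "h t = g (t + j) + max 0 (- j)" using hex by blast
    obtain k where k: "h (t + 1) = g (t + 1 + k) + max 0 (- k)" using hex by blast
    have "h t \<le> h (t + 1)" using hle[of t "1 + k"] k by (simp add: algebra_simps)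
    moreover have "h (t + 1) \<le> h t + 1" using hle[of "t + 1" "j - 1"] j by (simp add: algebra_simps)
    ultimately show "h t \<le> h (t + 1) \<and> h (t + 1) \<le> h t + 1" by simp
  qed
  moreover have "profile q h" unfolding profile_def using sh asy by blast
  ultimately show ?thesis using that hg by blast
qed

text \<open>The minimum is taken over regularized profiles only: they share a strip, so the minimum
  is again a profile, and every profile lies above a regularized one.\<close>

lemma least_profile:
  fixes q :: "int ^ 'n::finite"
  assumes q: "primitive_vec q"
  obtains g where "profile q g" "\<And>h t. profile q h \<Longrightarrow> g t \<le> h t"
proof -
  obtain C where C: "C \<ge> 0" "\<And>g t. \<lbrakk>profile q g; unit_slopes g; C \<le> \<bar>t\<bar>\<rbrakk> \<Longrightarrow> g t = min 0 t"
    using profile_uniform_bound[OF q] by blast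
  define A where "A = {g. profile q g \<and> unit_slopes g}"
  have "min 0 \<in> A"
  proof -
    have "lap1 q (min 0) t \<le> 0" for t
      unfolding lap1_def by (rule sum_nonpos) linarith
    thus ?thesis by (auto simp: A_def profile_def unit_slopes_def)
  qed
  hence "A \<noteq> {}" by blast
  moreover have "\<exists>K. \<forall>g\<in>A. K \<le> g t" for t
  proof (intro exI ballI)
    fix g assume "g \<in> A"
    hence g: "profile q g" "unit_slopes g" by (auto simp: A_def)
    have "g (- C - \<bar>t\<bar>) \<le> g t" by (rule unit_slopes_mono[OF g(2)]) (use C(1) in linarith)
    thus "- C - \<bar>t\<bar> \<le> g t" using C(2)[OF g, of "- C - \<bar>t\<bar>"] C(1) by simp
  qed
  ultimately obtain h where h: "\<And>t. \<exists>k\<in>A. h t = k t" "\<And>k t. k \<in> A \<Longrightarrow> h t \<le> k t"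
    by (rule pointwise_min) blast
  have "lap1 q h t \<le> 0" for t
  proof (rule lap1_pointwise_min [of A h])
    show "\<exists>k\<in>A. h t = k t" for t by (rule h(1))
    show "h t \<le> k t" if "k \<in> A" for k t using that by (rule h(2))
  qed (auto simp: A_def profile_def)
  moreover have "h t = min 0 t" if "C \<le> \<bar>t\<bar>" for t using h(1)[of t] C(2)[OF _ _ that] by (auto simp: A_def)
  ultimately have "profile q h" by (auto simp: profile_def)
  moreover have "h t \<le> k t" if k: "profile q k" for k t
  proof -
    obtain l where l: "profile q l" "unit_slopes l" "l t \<le> k t" using profile_regularize[OF k] by metis
    hence "h t \<le> l t" using h(2) by (simp add: A_def)
    thus ?thesis using l(3) by simp
  qed
  ultimately show ?thesis using that by blast
qed

subsection \<open>The least potential\<close>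

text \<open>\<open>dominates q F\<close> compares \<open>F\<close> with \<open>min 0 (q \<cdot> z)\<close> off a strip and asks for a mere lower bound
  inside; only this much is needed of the competitors of the least potential.\<close>

definition edge :: "int \<Rightarrow> int \<Rightarrow> int" where
  "edge C t = (if C \<le> \<bar>t\<bar> then min 0 t else - C)"

definition dominates :: "int ^ 'n::finite \<Rightarrow> (int ^ 'n \<Rightarrow> int) \<Rightarrow> bool" where
  "dominates q F \<longleftrightarrow> (\<exists>C\<ge>0. \<forall>z. edge C (idot q z) \<le> F z)"

definition least_potential :: "int ^ 'n::finite \<Rightarrow> (int ^ 'n \<Rightarrow> int) \<Rightarrow> bool" where
  "least_potential q \<theta> \<longleftrightarrow> superharmonic \<theta> \<and> dominates q \<theta> \<and>
     (\<exists>C. \<forall>z. C \<le> \<bar>idot q z\<bar> \<longrightarrow> \<theta> z = min 0 (idot q z)) \<and>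
     (\<forall>F z. superharmonic F \<longrightarrow> dominates q F \<longrightarrow> \<theta> z \<le> F z)"

lemma dominatesI: "0 \<le> C \<Longrightarrow> (\<And>z. edge C (idot q z) \<le> F z) \<Longrightarrow> dominates q F"
  by (auto simp: dominates_def)

lemma dominates_shift:
  assumes "dominates q F" "0 \<le> c" "- idot q w \<le> c"
  shows "dominates q (\<lambda>z. F (z + w) + c)"
proof -
  obtain C where C: "0 \<le> C" "\<And>z. edge C (idot q z) \<le> F z" using assms(1) by (auto simp: dominates_def)
  show ?thesis
  proof (rule dominatesI)
    show "0 \<le> C + 2 * \<bar>idot q w\<bar>" using C(1) by simp
    fix z
    have "edge (C + 2 * \<bar>idot q w\<bar>) (idot q z) \<le> edge C (idot q z + idot q w) + c"
      using assms(2,3) C(1) unfolding edge_def by (smt (verit))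
    thus "edge (C + 2 * \<bar>idot q w\<bar>) (idot q z) \<le> F (z + w) + c"
      using C(2)[of "z + w"] by (simp add: idot_add)
  qed
qed

lemma dominates_reflect:
  assumes "dominates (- q) F"
  shows "dominates q (\<lambda>z. F z + idot q z)"
proof -
  obtain C where C: "0 \<le> C" "\<And>z. edge C (- idot q z) \<le> F z"
    using assms by (auto simp: dominates_def idot_uminus_left)
  show ?thesis
  proof (rule dominatesI)
    show "0 \<le> 2 * C" using C(1) by simp
    show "edge (2 * C) (idot q z) \<le> F z + idot q z" for z
      using C(1) C(2)[of z] unfolding edge_def by (smt (verit))
  qed
qed

text \<open>A competitor may vary within a level. Its minimum over each level, attained because the
  values there are integers bounded below, is capped with \<open>min 0 t\<close> and becomes a
  profile, which lies above the least one.\<close>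

lemma least_potential_exists:
  fixes q :: "int ^ 'n::finite"
  assumes q: "primitive_vec q"
  obtains \<theta> where "least_potential q \<theta>"
proof -
  obtain g where g: "profile q g" "\<And>h t. profile q h \<Longrightarrow> g t \<le> h t" using least_profile[OF q] by blast
  obtain C where C: "C \<ge> 0" "\<And>t. C \<le> \<bar>t\<bar> \<Longrightarrow> g t = min 0 t" "\<And>t. min 0 t - C \<le> g t"
    using profile_lower_bound[OF g(1)] by blast
  obtain v where v: "\<And>t. idot q (t *s v) = t" using primitive_idot[OF q] by blast
  let ?\<theta> = "\<lambda>z. g (idot q z)"
  have "superharmonic ?\<theta>" using g(1) by (simp add: superharmonic_def lap_level profile_def)
  moreover have "dominates q ?\<theta>"
  proof (rule dominatesI)
    show "0 \<le> 2 * C" using C(1) by simp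
    show "edge (2 * C) (idot q z) \<le> g (idot q z)" for z
      using C(1) C(2)[of "idot q z"] C(3)[of "idot q z"] unfolding edge_def by (smt (verit))
  qed
  moreover have "\<exists>C. \<forall>z. C \<le> \<bar>idot q z\<bar> \<longrightarrow> ?\<theta> z = min 0 (idot q z)" using C(2) by blast
  moreover have "?\<theta> z \<le> F z" if F: "superharmonic F" "dominates q F" for F z
  proof -
    obtain D where D: "0 \<le> D" "\<And>z. edge D (idot q z) \<le> F z" using F(2) by (auto simp: dominates_def)
    have "\<exists>y\<in>{z. idot q z = t}. \<forall>z\<in>{z. idot q z = t}. F y \<le> F z" for t
      by (rule int_bdd_below_attains[of "t *s v" _ "edge D t"]) (use v D(2) in auto)
    hence "\<exists>y. idot q y = t \<and> (\<forall>z. idot q z = t \<longrightarrow> F y \<le> F z)" for t by blast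
    then obtain \<zeta> where "\<And>t. idot q (\<zeta> t) = t \<and> (\<forall>z. idot q z = t \<longrightarrow> F (\<zeta> t) \<le> F z)"
      by meson
    hence \<zeta>: "\<And>t. idot q (\<zeta> t) = t" "\<And>t z. idot q z = t \<Longrightarrow> F (\<zeta> t) \<le> F z" by blast+
    define h where "h t = min (F (\<zeta> t)) (min 0 t)" for t
    have "lap1 q h t \<le> 0" for t
    proof (cases "h t = min 0 t")
      case True
      have "lap1 q h t \<le> lap1 q (min 0) t" by (rule lap1_mono_at) (use True in \<open>auto simp: h_def\<close>)
      also have "\<dots> \<le> 0" unfolding lap1_def by (rule sum_nonpos) linarith
      finally show ?thesis .
    next
      case False
      hence ht: "h t = F (\<zeta> t)" by (auto simp: h_def)
      have "lap1 q h t \<le> lap F (\<zeta> t)" unfolding lap1_def lap_def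
      proof (rule sum_mono)
        fix i
        have "h (t + q $ i) \<le> F (\<zeta> t + axis i 1)" "h (t - q $ i) \<le> F (\<zeta> t - axis i 1)"
          by (auto simp: h_def idot_simps \<zeta>(1) intro!: min.coboundedI1 \<zeta>(2))
        thus "h (t + q $ i) + h (t - q $ i) - 2 * h t
            \<le> F (\<zeta> t + axis i 1) + F (\<zeta> t - axis i 1) - 2 * F (\<zeta> t)" using ht by simp
      qed
      also have "\<dots> \<le> 0" using F(1) by (simp add: superharmonic_def)
      finally show ?thesis .
    qed
    moreover have "h t = min 0 t" if "D \<le> \<bar>t\<bar>" for t
      using D(2)[of "\<zeta> t"] that by (simp add: h_def \<zeta>(1) edge_def)
    ultimately have "profile q h" by (auto simp: profile_def)
    hence "g (idot q z) \<le> h (idot q z)" by (rule g(2))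
    also have "\<dots> \<le> F (\<zeta> (idot q z))" by (simp add: h_def)
    also have "\<dots> \<le> F z" by (rule \<zeta>(2)) simp
    finally show ?thesis .
  qed
  ultimately show ?thesis using that unfolding least_potential_def by blast
qed

section \<open>Symmetries, bounds and motion of the least potential\<close>

context
  fixes q :: "int ^ 'n::finite" and \<theta>
  assumes lp: "least_potential q \<theta>"
begin

lemma lp_superharmonic: "superharmonic \<theta>" and lp_dominates: "dominates q \<theta>"
  and lp_least: "superharmonic F \<Longrightarrow> dominates q F \<Longrightarrow> \<theta> z \<le> F z"
  using lp by (auto simp: least_potential_def)

lemma lp_asymptotics:
  obtains C where "0 \<le> C" "\<And>z. C \<le> \<bar>idot q z\<bar> \<Longrightarrow> \<theta> z = min 0 (idot q z)" 
    "\<And>z. edge C (idot q z) \<le> \<theta> z"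
proof -
  obtain C where C: "\<And>z. C \<le> \<bar>idot q z\<bar> \<Longrightarrow> \<theta> z = min 0 (idot q z)"
    using lp by (auto simp: least_potential_def)
  obtain D where D: "0 \<le> D" "\<And>z. edge D (idot q z) \<le> \<theta> z" using lp_dominates by (auto simp: dominates_def)
  have "edge (\<bar>C\<bar> + D) t \<le> edge D t" for t using D(1) by (auto simp: edge_def)
  hence "edge (\<bar>C\<bar> + D) (idot q z) \<le> \<theta> z" for z using D(2) order_trans by blast
  thus ?thesis using C D(1) by (intro that[of "\<bar>C\<bar> + D"]) auto
qed

text \<open>A translate of \<open>\<theta>\<close> by a vector of nonnegative level is itself a
  competitor. For the opposite translation, in \<open>lp_slope\<close>, an added constant restores
  domination.\<close>

lemma lp_mono:
  assumes "0 \<le> idot q w" shows "\<theta> z \<le> \<theta> (z + w)"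
  using lp_least[OF superharmonic_shift[OF lp_superharmonic]] dominates_shift[OF lp_dominates, of 0 w] assms
  by simp

lemma lp_slope:
  assumes "0 \<le> idot q w" shows "\<theta> (z + w) \<le> \<theta> z + idot q w"
proof -
  have "\<theta> (z + w) \<le> \<theta> (z + w + - w) + idot q w"
    by (rule lp_least[OF superharmonic_add_const[OF superharmonic_shift[OF lp_superharmonic]]])
      (rule dominates_shift[OF lp_dominates]; simp add: assms idot_uminus)
  thus ?thesis by simp
qed

lemma lp_invariant: "idot q w = 0 \<Longrightarrow> \<theta> (z + w) = \<theta> z"
  using lp_mono[of w z] lp_slope[of w z] by simp

lemma lp_nonpos: "\<theta> z \<le> 0"
proof -
  have "superharmonic (\<lambda>z. min 0 (idot q z))" unfolding superharmonic_def lap_def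
    by (intro allI sum_nonpos) (simp add: idot_simps, linarith?)
  moreover have "dominates q (\<lambda>z. min 0 (idot q z))"
    by (rule dominatesI[of 0]) (auto simp: edge_def)
  ultimately have "\<theta> z \<le> min 0 (idot q z)" by (rule lp_least)
  thus ?thesis by simp
qed

text \<open>Minimality makes the state nonnegative: were the Laplacian at \<open>y\<close> at most
  \<open>- 2n\<close>, lowering \<open>\<theta>\<close> by one at \<open>y\<close> would keep it
  superharmonic and, after widening the strip, dominating.\<close>

lemma lp_lap_bound: "lap \<theta> y > - 2 * int CARD('n)"
proof (rule ccontr)
  assume a: "\<not> ?thesis"
  define K where "K z = \<theta> z - ind {y} z" for z
  obtain C where C: "0 \<le> C" "\<And>z. edge C (idot q z) \<le> \<theta> z" using lp_asymptotics by metis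
  have "superharmonic K" unfolding superharmonic_def
  proof
    fix z
    have *: "lap K z = lap \<theta> z - lap (ind {y}) z" unfolding K_def by (rule lap_diff)
    show "lap K z \<le> 0"
    proof (cases "z = y")
      case True
      have "lap (ind {y}) y \<ge> (\<Sum>i\<in>(UNIV::'n set). - 2)" unfolding lap_def by (rule sum_mono) simp
      thus ?thesis using a * True by simp
    next
      case False
      hence "lap (ind {y}) z \<ge> 0" by (intro lap_ind_nonneg) simp
      thus ?thesis using * lp_superharmonic[unfolded superharmonic_def, rule_format, of z] by linarith
    qed
  qed
  moreover have "dominates q K"
  proof (rule dominatesI)
    let ?D = "C + \<bar>idot q y\<bar> + 1"
    show "0 \<le> ?D" using C(1) by simp
    show "edge ?D (idot q z) \<le> K z" for z
    proof (cases "z = y")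
      case True
      thus ?thesis using C(1) C(2)[of y] by (simp add: K_def edge_def split: if_splits)
    next
      case False
      thus ?thesis using C(1) C(2)[of z] by (auto simp: K_def edge_def split: if_splits)
    qed
  qed
  ultimately have "\<theta> y \<le> K y" by (rule lp_least)
  thus False by (simp add: K_def)
qed

lemma lp_harmonic_off_strip:
  obtains C where "0 \<le> C" "\<And>z. C \<le> \<bar>idot q z\<bar> \<Longrightarrow> lap \<theta> z = 0"
    "\<And>z. C \<le> \<bar>idot q z\<bar> \<Longrightarrow> \<theta> z = min 0 (idot q z)" "\<And>z. edge C (idot q z) \<le> \<theta> z"
proof -
  obtain C where C: "0 \<le> C" "\<And>z. C \<le> \<bar>idot q z\<bar> \<Longrightarrow> \<theta> z = min 0 (idot q z)"
    "\<And>z. edge C (idot q z) \<le> \<theta> z" using lp_asymptotics by blast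
  define a where "a = (\<Sum>i\<in>UNIV. \<bar>q $ i\<bar>)"
  have a: "\<bar>q $ i\<bar> \<le> a" for i unfolding a_def by (rule member_le_sum) auto
  have a0: "a \<ge> 0" unfolding a_def by (rule sum_nonneg) auto
  show ?thesis
  proof (rule that)
    show "0 \<le> C + a" using C(1) a0 by simp
    show "\<theta> z = min 0 (idot q z)" if "C + a \<le> \<bar>idot q z\<bar>" for z using C(2)[of z] that a0 by simp
    show "edge (C + a) (idot q z) \<le> \<theta> z" for z
      using C(3)[of z] C(1) a0 unfolding edge_def by (smt (verit))
    fix z assume z: "C + a \<le> \<bar>idot q z\<bar>"
    have nb: "C \<le> \<bar>idot q z + q $ i\<bar> \<and> C \<le> \<bar>idot q z - q $ i\<bar>" for i using z a[of i] by linarith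
    have sg: "idot q z + q $ i \<le> 0 \<and> idot q z - q $ i \<le> 0" if "idot q z \<le> 0" for i
      using z a[of i] C(1) that by linarith
    have sg': "idot q z + q $ i \<ge> 0 \<and> idot q z - q $ i \<ge> 0" if "idot q z \<ge> 0" for i
      using z a[of i] C(1) that by linarith
    show "lap \<theta> z = 0"
    proof (cases "idot q z \<le> 0")
      case True
      have "lap \<theta> z = lap (idot q) z"
        by (rule lap_cong_near) (use nb sg True z a0 in \<open>simp_all add: C(2) idot_simps\<close>)
      thus ?thesis by (simp add: lap_idot)
    next
      case False
      have "lap \<theta> z = lap (\<lambda>_. 0) z"
        by (rule lap_cong_near) (use nb sg' False z a0 in \<open>simp_all add: C(2) idot_simps\<close>)
      thus ?thesis by (simp add: lap_const)
    qed
  qed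
qed

text \<open>Subtracting the harmonic function \<open>idot q\<close> exchanges the two sides without
  changing the state, which lets uniqueness assume \<open>0 \<le> idot q v\<close>.\<close>

lemma lp_reflect: "least_potential (- q) (\<lambda>z. \<theta> z - idot q z)"
proof -
  have sup: "superharmonic (\<lambda>z. F z + idot p z)" if "superharmonic F" for F and p :: "int ^ 'n"
    using that by (simp add: superharmonic_def lap_add lap_idot)
  have m: "(\<lambda>z. \<theta> z - idot q z) = (\<lambda>z. \<theta> z + idot (- q) z)" by (simp add: idot_uminus_left)
  have "superharmonic (\<lambda>z. \<theta> z - idot q z)" unfolding m by (rule sup[OF lp_superharmonic])
  moreover have "dominates (- q) (\<lambda>z. \<theta> z - idot q z)"
    unfolding m by (rule dominates_reflect) (simp add: lp_dominates)
  moreover have "\<exists>C. \<forall>z. C \<le> \<bar>idot (- q) z\<bar> \<longrightarrow> \<theta> z - idot q z = min 0 (idot (- q) z)"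
  proof -
    obtain C where "\<And>z. C \<le> \<bar>idot q z\<bar> \<Longrightarrow> \<theta> z = min 0 (idot q z)"
      using lp by (auto simp: least_potential_def)
    thus ?thesis by (intro exI[of _ C]) (auto simp: idot_uminus_left)
  qed
  moreover have "\<theta> z - idot q z \<le> F z" if "superharmonic F" "dominates (- q) F" for F z
    using lp_least[OF sup[OF that(1)] dominates_reflect[OF that(2)], of z] by simp
  ultimately show ?thesis unfolding least_potential_def by blast
qed

text \<open>Two minimalities meet. The increment \<open>u\<close> of \<open>\<theta>\<close> along
  \<open>v\<close> competes with the wave, so the toppled set \<open>T\<close> satisfies
  \<open>ind T z \<le> u z\<close>; conversely \<open>\<theta> + ind T\<close>, translated by
  \<open>v\<close>, competes with \<open>\<theta>\<close>, so
  \<open>u z \<le> ind T z\<close>.\<close>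

lemma lp_movable:
  assumes v: "idot q v = 1"
  shows "movable_by v (\<lambda>z. 2 * int CARD('n) - 1 + lap \<theta> z)"
proof -
  define \<phi> where "\<phi> z = 2 * int CARD('n) - 1 + lap \<theta> z" for z
  obtain C where C: "0 \<le> C" "\<And>z. C \<le> \<bar>idot q z\<bar> \<Longrightarrow> lap \<theta> z = 0"
    "\<And>z. C \<le> \<bar>idot q z\<bar> \<Longrightarrow> \<theta> z = min 0 (idot q z)" "\<And>z. edge C (idot q z) \<le> \<theta> z"
    using lp_harmonic_off_strip by blast
  \<comment> \<open>At this level both \<open>z0\<close> and \<open>z0 + v\<close> lie where
    \<open>\<theta>\<close> is the level itself, so \<open>u z0 = 1\<close>.\<close>
  define z0 where "z0 = (- C - 1) *s v"
  have z0: "idot q z0 = - C - 1" unfolding z0_def idot_scale v by simp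
  have full: "\<phi> z = 2 * int CARD('n) - 1" if "idot q z \<le> - C" for z
    using C(1) C(2)[of z] that by (simp add: \<phi>_def)
  have stable: "\<phi> z < 2 * int CARD('n)" for z
    using lp_superharmonic[unfolded superharmonic_def, rule_format, of z] by (simp add: \<phi>_def)
  obtain R where R: "relaxes_to (topple z0 \<phi>) (\<lambda>z. \<phi> z + lap (ind R) z)"
    by (rule wave_exists[of \<phi> z0, OF stable])
  obtain T where T: "z0 \<in> T" "\<forall>z. \<phi> z + lap (ind R) z = \<phi> z + lap (ind T) z"
    "\<forall>u. (\<forall>z. 0 \<le> u z) \<longrightarrow> 1 \<le> u z0 \<longrightarrow> (\<forall>z. \<phi> z + lap u z < 2 * int CARD('n))
      \<longrightarrow> (\<forall>z. ind T z \<le> u z)"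
    by (rule wave_least[OF R stable])
  have Tst: "\<phi> z + lap (ind T) z < 2 * int CARD('n)" for z using R T(2) by (simp add: relaxes_to_def)
  have left: "z \<in> T" if "idot q z \<le> - C" for z
    using wave_all_or_none[OF Tst full, of q "- C" z z0] that z0 T(1) by simp
  define u where "u z = \<theta> (z + v) - \<theta> z" for z
  have lapu: "lap u z = lap \<theta> (z + v) - lap \<theta> z" for z
    unfolding u_def by (simp only: lap_diff lap_shift)
  have "ind T z \<le> u z" for z
  proof -
    have "0 \<le> u z" for z using lp_mono[of v z] v by (simp add: u_def)
    moreover have "1 \<le> u z0" using C(3)[of z0] C(3)[of "z0 + v"] C(1) z0 by (simp add: u_def idot_add v)
    moreover have "\<phi> z + lap u z < 2 * int CARD('n)" for z
      unfolding lapu \<phi>_def using stable[of "z + v"] by (simp add: \<phi>_def)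
    ultimately show ?thesis using T(3) by blast
  qed
  moreover have "u z \<le> ind T z" for z
  proof -
    \<comment> \<open>Superharmonic because the state after the wave is stable; dominating because
      the wave covers the left half-space and so makes up for the unit lost by the
      translation.\<close>
    define K where "K z = \<theta> (z - v) + ind T (z - v)" for z
    have "superharmonic K" unfolding superharmonic_def
    proof
      fix z
      have "lap K z = lap (\<lambda>z. \<theta> z + ind T z) (z - v)"
        unfolding K_def by (rule lap_shift_diff)
      also have "\<dots> = lap \<theta> (z - v) + lap (ind T) (z - v)" by (rule lap_add)
      finally show "lap K z \<le> 0" using Tst[of "z - v"] by (simp add: \<phi>_def)
    qed
    moreover have "dominates q K"
    proof (rule dominatesI)
      show "0 \<le> C + 2" using C(1) by simp
      fix z
      have i: "idot q (z - v) = idot q z - 1" by (simp add: idot_diff v)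
      show "edge (C + 2) (idot q z) \<le> K z"
      proof (cases "idot q z \<le> - (C + 2)")
        case True
        hence "z - v \<in> T" by (intro left) (simp add: i)
        thus ?thesis using C(3)[of "z - v"] True C(1) by (simp add: K_def i edge_def)
      next
        case False
        hence "edge (C + 2) (idot q z) \<le> \<theta> (z - v)"
          using C(4)[of "z - v"] C(1) unfolding edge_def i by (smt (verit))
        thus ?thesis by (simp add: K_def)
      qed
    qed
    ultimately have "\<theta> (z + v) \<le> K (z + v)" by (rule lp_least)
    thus ?thesis by (simp add: u_def K_def)
  qed
  ultimately have "ind T = u" by (simp add: fun_eq_iff order_antisym)
  hence "\<phi> z + lap (ind R) z = \<phi> (z + v)" for z using T(2) by (simp add: lapu \<phi>_def)
  hence rel: "relaxes_to (topple z0 \<phi>) (\<lambda>z. \<phi> (z + v))" using R by simp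
  obtain z' where z': "adj z0 z'" "idot q z' \<le> - C"
  proof -
    fix i :: 'n
    show ?thesis
    proof (cases "q $ i \<ge> 0")
      case True
      thus ?thesis by (intro that[of "z0 - axis i 1"]) (auto simp: adj_iff idot_simps z0)
    next
      case False
      thus ?thesis by (intro that[of "z0 + axis i 1"]) (auto simp: adj_iff idot_simps z0)
    qed
  qed
  have "wave z0 \<phi> (\<lambda>z. \<phi> (z + v))"
    unfolding wave_def using rel z' full z0 by (auto intro!: exI[of _ z'])
  moreover have "\<not> (\<forall>z. \<phi> z = \<phi> (z + v))"
  proof
    assume inv: "\<forall>z. \<phi> z = \<phi> (z + v)"
    have "\<phi> (z + int n *s v) = \<phi> z" for z n
    proof (induction n)
      case (Suc n)
      have "z + int (Suc n) *s v = (z + int n *s v) + v" by (simp add: vec_eq_iff algebra_simps)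
      thus ?case using inv Suc by metis
    qed simp
    hence inv': "lap \<theta> (z + int n *s v) = lap \<theta> z" for z n by (simp add: \<phi>_def)
    \<comment> \<open>Translations by \<open>v\<close> lead from \<open>z\<close> beyond the strip,
      where \<open>\<theta>\<close> is harmonic. A globally harmonic \<open>\<theta>\<close>, being
      bounded above, would be constant.\<close>
    have "lap \<theta> z = 0" for z
    proof -
      have "lap \<theta> (z + int (nat (C + \<bar>idot q z\<bar>)) *s v) = 0"
        by (rule C(2)) (use C(1) in \<open>simp add: idot_add idot_scale v\<close>)
      thus ?thesis by (simp only: inv')
    qed
    hence "superharmonic (\<lambda>z. - \<theta> z)" by (simp add: superharmonic_def lap_minus)
    hence "- \<theta> z0 = - \<theta> (z0 + v)" by (rule superharmonic_bdd_below_const[of _ 0]) (simp add: lp_nonpos)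
    thus False using C(3)[of z0] C(3)[of "z0 + v"] C(1) z0 by (simp add: idot_add v)
  qed
  moreover have "v \<noteq> 0" using v by (auto simp: idot_def)
  ultimately show ?thesis unfolding movable_by_def \<phi>_def by blast
qed

end

subsection \<open>Periods\<close>

lemma real_vec_simps:
  "real_vec 0 = 0" "real_vec (x - y) = real_vec x - real_vec y"
  "real_vec (k *s x) = real_of_int k *\<^sub>R real_vec x"
  by (auto simp: real_vec_def vec_eq_iff)

lemma real_vec_sum: "real_vec (sum f A) = (\<Sum>a\<in>A. real_vec (f a))"
  by (simp add: real_vec_def vec_eq_iff)

lemma inner_real_vec: "real_vec q \<bullet> real_vec z = real_of_int (idot q z)"
  by (simp add: inner_vec_def real_vec_def idot_def)

lemma real_vec_eq_0_iff: "real_vec q = 0 \<longleftrightarrow> q = 0"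
  by (auto simp: real_vec_def vec_eq_iff)

lemma sublattice_hyperplane: "sublattice {z. idot q z = 0}"
  by (auto simp: sublattice_def idot_diff) (simp add: idot_def)

lemma dim_real_hyperplane:
  fixes q :: "int ^ 'n::finite"
  assumes "q \<noteq> 0"
  shows "dim {x. real_vec q \<bullet> x = 0} = CARD('n) - 1"
  using dim_hyperplane[of "real_vec q"] assms by (simp add: real_vec_eq_0_iff)

lemma lattice_rank_hyperplane:
  fixes q :: "int ^ 'n::finite"
  assumes "q \<noteq> 0"
  shows "lattice_rank {z. idot q z = 0} = CARD('n) - 1"
proof -
  let ?L = "{z. idot q z = 0}" and ?H = "{x. real_vec q \<bullet> x = 0}"
  obtain k where k: "q $ k \<noteq> 0" using assms by (auto simp: vec_eq_iff)
  have "?H \<subseteq> span (real_vec ` ?L)"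
  proof
    fix x assume "x \<in> ?H"
    hence x: "(\<Sum>j\<in>UNIV. real_of_int (q $ j) * x $ j) = 0" by (simp add: inner_vec_def real_vec_def)
    \<comment> \<open>Integer vectors of the hyperplane in which every real \<open>x\<close> of the
      hyperplane has the coefficients \<open>x $ j / q $ k\<close>.\<close>
    define l where "l j = axis j (q $ k) - axis k (q $ j)" for j
    have "l j \<in> ?L" for j by (simp add: l_def idot_simps)
    hence "(\<Sum>j\<in>UNIV. (x $ j / q $ k) *\<^sub>R real_vec (l j)) \<in> span (real_vec ` ?L)"
      by (intro span_sum span_scale span_base imageI)
    moreover have "(\<Sum>j\<in>UNIV. (x $ j / q $ k) *\<^sub>R real_vec (l j)) = x"
    proof -
      have "(\<Sum>j\<in>UNIV. (x $ j / q $ k) * real_of_int (l j $ i)) = x $ i" for i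
      proof -
        have "(\<Sum>j\<in>UNIV. (x $ j / q $ k) * real_of_int (l j $ i))
          = (\<Sum>j\<in>UNIV. (if j = i then x $ i else 0) - (real_of_int (q $ j) * x $ j) * ((if k = i then 1 else 0) / q $ k))"
          using k by (intro sum.cong) (auto simp: l_def axis_def)
        also have "\<dots> = x $ i" by (simp only: sum_subtractf sum_distrib_right [symmetric] x) simp
        finally show ?thesis .
      qed
      thus ?thesis by (simp add: vec_eq_iff real_vec_def)
    qed
    ultimately show "x \<in> span (real_vec ` ?L)" by simp
  qed
  hence "dim ?H \<le> dim (real_vec ` ?L)" by (metis dim_span dim_subset)
  moreover have "dim (real_vec ` ?L) \<le> dim ?H"
    by (rule dim_subset) (auto simp: inner_real_vec)
  ultimately show ?thesis by (simp add: lattice_rank_def dim_real_hyperplane[OF assms])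
qed

lemma sublattice_sum:
  assumes L: "sublattice L" and "finite A" "\<And>a. a \<in> A \<Longrightarrow> l a \<in> L"
  shows "(\<Sum>a\<in>A. c a *s l a) \<in> L"
proof -
  have zero: "0 \<in> L" using L by (simp add: sublattice_def)
  have diff: "x - y \<in> L" if "x \<in> L" "y \<in> L" for x y
    using L that by (simp add: sublattice_def)
  have neg: "- x \<in> L" if "x \<in> L" for x using diff[OF zero that] by simp
  have add: "x + y \<in> L" if "x \<in> L" "y \<in> L" for x y using diff[OF that(1) neg[OF that(2)]] by simp
  have mul: "int n *s x \<in> L" if "x \<in> L" for n x
  proof (induction n)
    case (Suc n)
    have "int (Suc n) *s x = x + int n *s x" by (simp add: vec_eq_iff algebra_simps)
    thus ?case using add[OF that Suc] by simp
  qed (simp add: zero)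
  have mulz: "k *s x \<in> L" if "x \<in> L" for k x
  proof (cases "k \<ge> 0")
    case True
    thus ?thesis using mul[OF that, of "nat k"] by simp
  next
    case False
    hence "k *s x = - (int (nat (- k)) *s x)" by (simp add: vec_eq_iff)
    thus ?thesis using neg[OF mul[OF that]] by metis
  qed
  show ?thesis using assms(2,3)
    by (induction rule: finite_induct) (auto simp: zero intro!: add mulz)
qed

lemma finite_box: "finite {x :: int ^ 'n::finite. \<forall>i. x $ i \<in> S}" if "finite S"
proof (rule finite_imageD)
  have "vec_nth ` {x :: int ^ 'n. \<forall>i. x $ i \<in> S} \<subseteq> PiE UNIV (\<lambda>_. S)" by auto
  thus "finite (vec_nth ` {x :: int ^ 'n. \<forall>i. x $ i \<in> S})"
    by (rule finite_subset) (simp add: finite_PiE that)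
  show "inj_on vec_nth {x :: int ^ 'n. \<forall>i. x $ i \<in> S}" by (auto simp: inj_on_def vec_nth_inject)
qed

text \<open>Reducing the multiples of \<open>w\<close> modulo a spanning set of \<open>L\<close> leaves finitely many
  remainders, so two multiples have the same one.\<close>

lemma multiple_in_sublattice:
  fixes L :: "(int ^ 'n::finite) set"
  assumes L: "sublattice L" and w: "real_vec w \<in> span (real_vec ` L)"
  obtains N where "N > 0" "N *s w \<in> L"
proof -
  obtain t r where t: "finite t" "t \<subseteq> real_vec ` L" "(\<Sum>a\<in>t. r a *\<^sub>R a) = real_vec w"
    using w unfolding span_explicit by auto
  have "\<forall>a\<in>t. \<exists>p. p \<in> L \<and> real_vec p = a" using t(2) by blast
  from bchoice[OF this] obtain l where l: "\<forall>a\<in>t. l a \<in> L \<and> real_vec (l a) = a" ..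
  define y where "y k = int k *s w - (\<Sum>a\<in>t. \<lfloor>real k * r a\<rfloor> *s l a)" for k :: nat
  define D where "D = \<lceil>\<Sum>a\<in>t. norm a\<rceil>"
  have y: "real_vec (y k) = (\<Sum>a\<in>t. frac (real k * r a) *\<^sub>R a)" for k
  proof -
    have "real_vec (y k) = (\<Sum>a\<in>t. real k *\<^sub>R (r a *\<^sub>R a)) - (\<Sum>a\<in>t. real_of_int \<lfloor>real k * r a\<rfloor> *\<^sub>R a)"
      unfolding y_def real_vec_simps real_vec_sum t(3) [symmetric] scaleR_sum_right using l by simp
    also have "\<dots> = (\<Sum>a\<in>t. frac (real k * r a) *\<^sub>R a)"
      unfolding sum_subtractf [symmetric] by (rule sum.cong) (auto simp: frac_def scaleR_left_diff_distrib)
    finally show ?thesis .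
  qed
  have "y k $ i \<in> {- D..D}" for k i
  proof -
    have "\<bar>real_vec (y k) $ i\<bar> \<le> norm (real_vec (y k))" by (rule component_le_norm_cart)
    also have "\<dots> \<le> (\<Sum>a\<in>t. norm (frac (real k * r a) *\<^sub>R a))" unfolding y by (rule norm_sum)
    also have "\<dots> \<le> (\<Sum>a\<in>t. norm a)"
      by (rule sum_mono) (simp add: mult_left_le_one_le frac_ge_0 frac_lt_1 less_imp_le)
    also have "\<dots> \<le> real_of_int D" unfolding D_def by (rule le_of_int_ceiling)
    finally have "\<bar>y k $ i\<bar> \<le> D" by (simp add: real_vec_def) 
    thus ?thesis by auto
  qed
  hence "range y \<subseteq> {x. \<forall>i. x $ i \<in> {- D..D}}" by auto
  hence "finite (range y)" by (rule finite_subset) (rule finite_box, simp)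
  hence "\<not> inj y" using finite_imageD infinite_UNIV_nat by blast
  then obtain j k where jk: "j < k" "y j = y k" unfolding inj_def by (metis linorder_neqE_nat)
  have "(int k - int j) *s w = (\<Sum>a\<in>t. (\<lfloor>real k * r a\<rfloor> - \<lfloor>real j * r a\<rfloor>) *s l a)"
    using jk(2) unfolding y_def vector_sub_rdistrib sum_subtractf by (simp add: algebra_simps)
  also have "\<dots> \<in> L" by (rule sublattice_sum[OF L t(1)]) (use l in blast)
  finally show ?thesis using jk(1) by (intro that[of "int k - int j"]) auto
qed

text \<open>Rank \<open>n - 1\<close> enters here: the real span of \<open>L\<close> has the
  dimension of the hyperplane containing it, so it contains every integer vector of that
  hyperplane.\<close>

lemma multiple_in_full_rank_sublattice:
  fixes L :: "(int ^ 'n::finite) set"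
  assumes L: "sublattice L" "lattice_rank L = CARD('n) - 1" and "q \<noteq> 0"
    and orth: "\<And>p. p \<in> L \<Longrightarrow> idot q p = 0" and w: "idot q w = 0"
  obtains N where "N > 0" "N *s w \<in> L"
proof -
  let ?H = "{x. real_vec q \<bullet> x = 0}"
  have "span (real_vec ` L) = span ?H"
    by (rule dim_eq_span) (use L(2) orth in \<open>auto simp: lattice_rank_def dim_real_hyperplane[OF \<open>q \<noteq> 0\<close>] inner_real_vec\<close>)
  moreover have "real_vec w \<in> ?H" using w by (simp add: inner_real_vec)
  ultimately have "real_vec w \<in> span (real_vec ` L)" by (metis span_base)
  thus ?thesis using multiple_in_sublattice[OF L(1)] that by blast
qed

lemma lp_soliton:
  fixes q :: "int ^ 'n::finite"
  assumes q: "primitive_vec q" and lp: "least_potential q \<theta>"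
  shows "soliton q (\<lambda>z. 2 * int CARD('n) - 1 + lap \<theta> z)"
proof -
  let ?\<phi> = "\<lambda>z. 2 * int CARD('n) - 1 + lap \<theta> z"
  obtain v where v: "\<And>t. idot q (t *s v) = t" using primitive_idot[OF q] by blast
  have "sand_state ?\<phi>" unfolding sand_state_def
  proof
    show "0 \<le> ?\<phi> z" for z using lp_lap_bound[OF lp, of z] by linarith
  qed
  moreover have "periodic ?\<phi>" unfolding periodic_def
  proof (intro exI conjI)
    show "sublattice {z. idot q z = 0}" by (rule sublattice_hyperplane)
    show "lattice_rank {z. idot q z = 0} = CARD('n) - 1"
      by (rule lattice_rank_hyperplane[OF primitive_nonzero[OF q]])
    have "lap \<theta> (z + p) = lap \<theta> z" if "idot q p = 0" for z p
      using lap_shift[of \<theta> p z] lp_invariant[OF lp that] by simp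
    thus "periodic_wrt {z. idot q z = 0} ?\<phi>" by (simp add: periodic_wrt_def)
  qed
  moreover have "movable ?\<phi>"
    unfolding movable_def using lp_movable[OF lp, of "1 *s v"] v by blast
  moreover have "hyperplane_shaped q ?\<phi>"
  proof -
    obtain C where C: "\<And>z. C \<le> \<bar>idot q z\<bar> \<Longrightarrow> lap \<theta> z = 0" by (rule lp_harmonic_off_strip[OF lp]) blast
    have "\<bar>idot q z\<bar> \<le> C" if "lap \<theta> z \<noteq> 0" for z using C[of z] that by linarith
    hence "{z. ?\<phi> z \<noteq> 2 * int CARD('n) - 1} \<subseteq> {z. real_of_int (- C) \<le> idot q z \<and> idot q z \<le> real_of_int C}"
      unfolding of_int_le_iff by fastforce
    thus ?thesis unfolding hyperplane_shaped_def by blast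
  qed
  ultimately show ?thesis by (simp add: soliton_def)
qed

subsection \<open>Uniqueness\<close>

text \<open>The hypothesis \<open>least\<close> is the minimality of the wave: \<open>F\<close>
  translated by \<open>v\<close> lies below every superharmonic majorant of \<open>F\<close> that is
  larger at \<open>z0\<close>. The proof moves the origin \<open>z0\<close> far to the left, where
  \<open>\<theta>\<close> passes the test for competitors; the converse inequality is the minimality
  of \<open>\<theta>\<close>.\<close>

lemma moving_potential_unique:
  fixes q :: "int ^ 'n::finite"
  assumes lp: "least_potential q \<theta>" and q0: "q \<noteq> 0" and v: "idot q v = 1"
    and sF: "superharmonic F"
    and asy: "\<And>z. C \<le> \<bar>idot q z\<bar> \<Longrightarrow> F z = min 0 (idot q z)"
    and slope: "\<And>z. F z \<le> F (z + v) \<and> F (z + v) \<le> F z + 1"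
    and z0: "lap F z0 = 0"
    and least: "\<And>F' z. \<lbrakk>superharmonic F'; \<And>y. F y \<le> F' y; F z0 < F' z0\<rbrakk> \<Longrightarrow> F (z + v) \<le> F' z"
    and per: "\<And>w. idot q w = 0 \<Longrightarrow> \<exists>N>0. \<forall>z. F (z + N *s w) = F z"
  shows "F z = \<theta> z"
proof -
  have up: "F z \<le> F (z + k *s v) \<and> F (z + k *s v) \<le> F z + k" if "k \<ge> 0" for z k
  proof -
    have "F z \<le> F (z + int n *s v) \<and> F (z + int n *s v) \<le> F z + int n" for n
    proof (induction n)
      case (Suc n)
      have e: "z + int (Suc n) *s v = (z + int n *s v) + v" by (simp add: vec_eq_iff algebra_simps)
      show ?case unfolding e using slope[of "z + int n *s v"] Suc by simp
    qed simp
    from this[of "nat k"] that show ?thesis by simp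
  qed
  have down: "F z - k \<le> F (z - k *s v) \<and> F (z - k *s v) \<le> F z" if "k \<ge> 0" for z k
    using up[OF that, of "z - k *s v"] by simp
  have F0: "F z \<le> 0" for z
  proof -
    let ?k = "\<bar>C\<bar> + \<bar>idot q z\<bar>"
    have "F (z + ?k *s v) = min 0 (idot q (z + ?k *s v))" by (rule asy) (simp add: idot_simps v)
    thus ?thesis using up[of ?k z] by simp
  qed
  have Fq: "F z \<le> idot q z" for z
  proof -
    let ?k = "\<bar>C\<bar> + \<bar>idot q z\<bar>"
    have "F (z - ?k *s v) = min 0 (idot q (z - ?k *s v))" by (rule asy) (simp add: idot_simps v)
    thus ?thesis using down[of ?k z] by (simp add: idot_simps v)
  qed
  have dom: "dominates q F"
  proof (rule dominatesI)
    show "0 \<le> 2 * \<bar>C\<bar>" by simp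
    show "edge (2 * \<bar>C\<bar>) (idot q z) \<le> F z" for z
    proof (cases "C \<le> \<bar>idot q z\<bar>")
      case True
      thus ?thesis using asy[OF True] by (auto simp: edge_def)
    next
      case False
      have "F (z + (2 * \<bar>C\<bar>) *s v) = min 0 (idot q (z + (2 * \<bar>C\<bar>) *s v))"
        by (rule asy) (use False in \<open>simp add: idot_simps v\<close>)
      hence "- (2 * \<bar>C\<bar>) \<le> F z" using up[of "2 * \<bar>C\<bar>" z] False by (simp add: idot_simps v)
      thus ?thesis using False by (auto simp: edge_def)
    qed
  qed
  \<comment> \<open>The sites that may replace \<open>z0\<close> as origin of the wave.\<close>
  define start where "start y \<longleftrightarrow> (\<forall>F'. superharmonic F' \<longrightarrow> (\<forall>x. F x \<le> F' x) \<longrightarrow> F y < F' y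
    \<longrightarrow> (\<forall>z. F (z + v) \<le> F' z))" for y
  have start0: "start z0" unfolding start_def using least by blast
  \<comment> \<open>Translated back by \<open>Suc k\<close> steps, \<open>F'\<close> lies above
    \<open>F\<close> and exceeds it at \<open>y\<close>, so one wave improves the bound by one
    translation; after all rounds \<open>F'\<close> itself lies above \<open>F\<close>. The obstacle
    is the value \<open>F y + 1\<close> on the ray of the later origins
    \<open>y + j *s v\<close>.\<close>
  have obstacle: "F z \<le> F' z"
    if st: "start y" and F': "superharmonic F'" "\<And>z. F (z - int k *s v) \<le> F' z"
      "\<And>j. j \<ge> 1 \<Longrightarrow> F y + 1 \<le> F' (y + j *s v)" for y F' k z
    using F'(2)
  proof (induction k arbitrary: z)
    case 0
    thus ?case by simp
  next
    case (Suc k)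
    define G where "G z = F' (z + int (Suc k) *s v)" for z
    have "superharmonic G" unfolding G_def by (rule superharmonic_shift[OF F'(1)])
    moreover have "F x \<le> G x" for x using Suc.prems[of "x + int (Suc k) *s v"] by (simp add: G_def)
    moreover have "F y < G y" using F'(3)[of "int (Suc k)"] by (simp add: G_def)
    ultimately have G: "F (x + v) \<le> G x" for x using st by (simp add: start_def)
    have "F (x - int k *s v) \<le> F' x" for x
    proof -
      have "x - int (Suc k) *s v + v = x - int k *s v" by (simp add: vec_eq_iff algebra_simps)
      thus ?thesis using G[of "x - int (Suc k) *s v"] by (simp add: G_def)
    qed
    thus ?case by (rule Suc.IH)
  qed
  have obstacle': "F z \<le> F' z"
    if st: "start y" and F': "superharmonic F'" "dominates q F'"
      "\<And>j. j \<ge> 1 \<Longrightarrow> F y + 1 \<le> F' (y + j *s v)" for y F' z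
  proof -
    obtain D where D: "0 \<le> D" "\<And>z. edge D (idot q z) \<le> F' z" using F'(2) by (auto simp: dominates_def)
    \<comment> \<open>In the strip the level is less than \<open>D\<close>, so going back by
      \<open>2 * D\<close> brings \<open>F\<close> below \<open>- D\<close>.\<close>
    have "F (z - int (nat (2 * D)) *s v) \<le> F' z" for z
    proof -
      have "F (z - (2 * D) *s v) \<le> idot q z - 2 * D" using Fq[of "z - (2 * D) *s v"] by (simp add: idot_simps v)
      moreover have "F (z - (2 * D) *s v) \<le> 0" by (rule F0)
      ultimately have "F (z - (2 * D) *s v) \<le> edge D (idot q z)" using D(1) unfolding edge_def by (smt (verit))
      thus ?thesis using D(2)[of z] D(1) by simp
    qed
    thus ?thesis by (rule obstacle[OF st F'(1)]) (rule F'(3))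
  qed
  have Fz0: "F z0 = idot q z0"
  proof (rule ccontr)
    assume "F z0 \<noteq> idot q z0"
    hence lt: "F z0 + 1 \<le> idot q z0" using Fq[of z0] by simp
    define a where "a = \<bar>C\<bar> + \<bar>idot q z0\<bar>"
    \<comment> \<open>Going back \<open>a\<close> translations from \<open>z0\<close> reaches the
      affine region, so raising by \<open>a\<close> gives the value \<open>idot q z0\<close>, larger
      than \<open>F z0\<close>. With one more translation back \<open>F'\<close> still passes the
      obstacle test, yet far left it lies below \<open>F\<close>.\<close>
    define F' where "F' z = F (z - (a + 1) *s v) + a" for z
    have a0: "a \<ge> 0" by (simp add: a_def)
    have "F (z0 - a *s v) = min 0 (idot q (z0 - a *s v))"
      by (rule asy) (simp add: idot_simps v a_def)
    hence Fa: "F (z0 - a *s v) = idot q z0 - a" by (simp add: idot_simps v a_def)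
    have "F z \<le> F' z" for z
    proof (rule obstacle[OF start0, where k = "nat (a + 1)"])
      show "superharmonic F'" unfolding F'_def
        by (intro superharmonic_add_const superharmonic_shift_diff sF)
      show "F (z - int (nat (a + 1)) *s v) \<le> F' z" for z using a0 by (simp add: F'_def)
      fix j :: int assume j: "j \<ge> 1"
      have e: "z0 + j *s v - (a + 1) *s v = (z0 - a *s v) + (j - 1) *s v"
        by (simp add: vec_eq_iff algebra_simps)
      have "F (z0 - a *s v) \<le> F (z0 + j *s v - (a + 1) *s v)"
        unfolding e using up[of "j - 1" "z0 - a *s v"] j by linarith
      thus "F z0 + 1 \<le> F' (z0 + j *s v)" using lt by (simp add: F'_def Fa)
    qed
    from this[of "- \<bar>C\<bar> *s v"] show False
      using asy[of "- \<bar>C\<bar> *s v"] Fq[of "- \<bar>C\<bar> *s v - (a + 1) *s v"]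
      unfolding F'_def idot_diff idot_scale v by simp
  qed
  \<comment> \<open>The bound \<open>F z \<le> idot q z\<close> is attained at \<open>z0\<close>,
    where \<open>F\<close> is harmonic, so it is attained at the neighbours.\<close>
  have nb: "F (z0 + axis i 1) = idot q (z0 + axis i 1)" "F (z0 - axis i 1) = idot q (z0 - axis i 1)" for i
    using superharmonic_min_step[of "\<lambda>z. idot q z - F z" z0 0 i] Fq Fz0 z0
    by (simp_all add: lap_diff lap_idot)
  obtain i where i: "q $ i \<noteq> 0" using q0 by (auto simp: vec_eq_iff)
  \<comment> \<open>A unit step raising the level by \<open>b\<close>; the vector \<open>w\<close>
    compares it with \<open>b\<close> translations by \<open>v\<close>.\<close>
  define e where "e = axis i (sgn (q $ i))"
  define b where "b = \<bar>q $ i\<bar>"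
  have e: "e = axis i 1 \<or> e = - axis i 1" using i by (cases "q $ i > 0") (auto simp: e_def axis_uminus)
  have b: "idot q e = b" "b \<ge> 1" using i by (auto simp: e_def b_def idot_axis sgn_if)
  have Fe: "F (z0 + e) = idot q z0 + b" using e nb[of i] b(1) by (auto simp: idot_simps)
  define w where "w = e - b *s v"
  have qw: "idot q w = 0" by (simp add: w_def idot_simps b v)
  \<comment> \<open>From its value \<open>idot q z0 + b\<close> at \<open>z0 + e\<close>,
    \<open>F\<close> drops by at most \<open>b - 1\<close> over \<open>b - 1\<close> backward
    translations. So the translate by \<open>w\<close> exceeds \<open>F z0\<close> along the whole
    ray and passes the obstacle test.\<close>
  have Fw_ge: "F z \<le> F (z + w)" for z
  proof (rule obstacle'[OF start0])
    show "superharmonic (\<lambda>z. F (z + w))" by (rule superharmonic_shift[OF sF])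
    show "dominates q (\<lambda>z. F (z + w))" using dominates_shift[OF dom, of 0 w] by (simp add: qw)
    fix j :: int assume j: "j \<ge> 1"
    have "idot q z0 + 1 \<le> F (z0 + e - (b - 1) *s v)" using down[of "b - 1" "z0 + e"] b(2) by (simp add: Fe)
    also have "\<dots> \<le> F (z0 + e - (b - 1) *s v + (j - 1) *s v)" using up[of "j - 1" "z0 + e - (b - 1) *s v"] j by linarith
    also have "z0 + e - (b - 1) *s v + (j - 1) *s v = z0 + j *s v + w"
      by (simp add: w_def vec_eq_iff algebra_simps)
    finally show "F z0 + 1 \<le> F (z0 + j *s v + w)" by (simp add: Fz0)
  qed
  \<comment> \<open>\<open>F\<close> does not decrease along \<open>w\<close>, and a positive
    multiple of \<open>w\<close> is a period.\<close>
  have Fw: "F (z + w) = F z" for z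
  proof -
    have "F x \<le> F (x + int n *s w)" for x n
    proof (induction n)
      case (Suc n)
      have e: "x + int (Suc n) *s w = (x + int n *s w) + w" by (simp add: vec_eq_iff algebra_simps)
      show ?case unfolding e using Suc Fw_ge[of "x + int n *s w"] by linarith
    qed simp
    moreover obtain N where N: "N > 0" "\<And>z. F (z + N *s w) = F z" using per[OF qw] by blast
    ultimately have "F (z + w) \<le> F (z + w + int (nat (N - 1)) *s w)" by blast
    also have "z + w + int (nat (N - 1)) *s w = z + N *s w" using N(1) by (simp add: vec_eq_iff algebra_simps)
    finally show ?thesis using N(2)[of z] Fw_ge[of z] by simp
  qed
  have Fke: "F (z - int k *s e) = F (z - (int k * b) *s v)" for z k
  proof (induction k arbitrary: z)
    case (Suc k)
    have "z - int (Suc k) *s e = z - e - int k *s e" by (simp add: vec_eq_iff algebra_simps)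
    hence "F (z - int (Suc k) *s e) = F (z - e - int k *s e)" by (simp only:)
    also have "\<dots> = F (z - e - (int k * b) *s v)" by (rule Suc)
    also have "\<dots> = F (z - e - (int k * b) *s v + w)" by (simp add: Fw)
    also have "z - e - (int k * b) *s v + w = z - (int (Suc k) * b) *s v"
      by (simp add: w_def vec_eq_iff algebra_simps)
    finally show ?case .
  qed simp
  have lin: "F (x - m *s v) = idot q (x - m *s v)" if "m \<ge> 0" "F x = idot q x" for x m
    using down[OF that(1), of x] Fq[of "x - m *s v"] that(2) by (simp add: idot_simps v)
  have lapv: "lap F (z0 - m *s v) = 0" if "m \<ge> 0" for m
  proof -
    have "F (z0 - m *s v + axis i 1) = idot q (z0 - m *s v + axis i 1)" 
      "F (z0 - m *s v - axis i 1) = idot q (z0 - m *s v - axis i 1)" for i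
      using lin[OF that nb(1)[of i]] lin[OF that nb(2)[of i]] by (simp_all add: algebra_simps)
    hence "lap F (z0 - m *s v) = lap (idot q) (z0 - m *s v)"
      by (intro lap_cong_near lin[OF that Fz0])
    thus ?thesis by (simp add: lap_idot)
  qed
  \<comment> \<open>The origin can be moved by \<open>- e\<close>: the invariance under
    \<open>w\<close> makes \<open>F\<close> harmonic at \<open>?p\<close>, so a superharmonic
    majorant touching \<open>F\<close> at \<open>?p\<close> touches it at all neighbours. Hence a
    majorant larger at \<open>?p - e\<close> is larger at \<open>?p\<close>.\<close>
  have start: "start (z0 - int k *s e)" for k
  proof (induction k)
    case 0
    thus ?case using start0 by simp
  next
    case (Suc k)
    let ?p = "z0 - int k *s e"
    have Sp: "z0 - int (Suc k) *s e = ?p - e" by (simp add: vec_eq_iff algebra_simps)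
    have "lap (\<lambda>z. F (z - int k *s e)) z0 = lap (\<lambda>z. F (z - (int k * b) *s v)) z0" by (simp only: Fke)
    hence lp0: "lap F ?p = 0" using lapv[of "int k * b"] b(2) by (simp add: lap_shift_diff)
    show ?case unfolding start_def Sp
    proof (intro allI impI)
      fix F' z assume F': "superharmonic F'" "\<forall>x. F x \<le> F' x" "F (?p - e) < F' (?p - e)"
      have "F ?p < F' ?p"
      proof (rule ccontr)
        assume "\<not> ?thesis"
        hence eq: "F' ?p - F ?p = 0" using F'(2) by (simp add: order_antisym)
        have l: "lap (\<lambda>z. F' z - F z) ?p \<le> 0" using F'(1) by (simp add: lap_diff lp0 superharmonic_def)
        have g: "0 \<le> F' x - F x" for x using F'(2) by simp
        have "F' (?p - e) - F (?p - e) = 0"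
          using superharmonic_min_step[OF l g eq, of i] e by auto
        thus False using F'(3) by simp
      qed
      thus "F (z + v) \<le> F' z" using Suc F'(1,2) by (simp add: start_def)
    qed
  qed
  have "F z \<le> \<theta> z"
  proof -
    obtain D where D: "0 \<le> D" "\<And>z. D \<le> \<bar>idot q z\<bar> \<Longrightarrow> \<theta> z = min 0 (idot q z)"
      "\<And>z. edge D (idot q z) \<le> \<theta> z" using lp_asymptotics[OF lp] by blast
    \<comment> \<open>Each step by \<open>- e\<close> lowers the level by at least \<open>1\<close>,
      so this many lead to the left of the strip of \<open>\<theta>\<close>.\<close>
    define k where "k = nat (\<bar>idot q z0\<bar> + D + 1)"
    define y where "y = z0 - int k *s e"
    have "int k * b \<ge> int k * 1" using b(2) by (intro mult_left_mono) auto
    moreover have "idot q y = idot q z0 - int k * b" unfolding y_def idot_diff idot_scale b(1) by simp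
    moreover have "int k = \<bar>idot q z0\<bar> + D + 1" using D(1) by (simp add: k_def)
    ultimately have qy: "idot q y \<le> - D - 1" by linarith
    have Fy: "F y = idot q y"
      unfolding y_def Fke using lin[OF _ Fz0, of "int k * b"] b by (simp add: idot_simps v)
    show ?thesis
    proof (rule obstacle'[of y])
      show "start y" unfolding y_def by (rule start)
      show "superharmonic \<theta>" "dominates q \<theta>" by (rule lp_superharmonic[OF lp], rule lp_dominates[OF lp])
      fix j :: int assume j: "j \<ge> 1"
      have "F y + 1 = \<theta> (y + v)" using D(2)[of "y + v"] qy D(1) by (simp add: Fy idot_add v)
      also have "\<dots> \<le> \<theta> (y + v + (j - 1) *s v)" by (rule lp_mono[OF lp]) (unfold idot_scale v, use j in simp)
      also have "y + v + (j - 1) *s v = y + j *s v" by (simp add: vec_eq_iff algebra_simps)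
      finally show "F y + 1 \<le> \<theta> (y + j *s v)" .
    qed
  qed
  moreover have "\<theta> z \<le> F z" by (rule lp_least[OF lp sF dom])
  ultimately show ?thesis by simp
qed

section \<open>From a soliton to its potential\<close>

text \<open>A discrete antiderivative along \<open>v\<close>: a translation by \<open>v\<close>
  changes it by minus the indicator of \<open>A\<close>. As \<open>card\<close> is \<open>0\<close>
  on infinite sets, this holds only where forward rays meet \<open>A\<close> finitely often, which
  \<open>tail_facts\<close> ensures.\<close>

definition tail :: "(int ^ 'n::finite) set \<Rightarrow> int ^ 'n \<Rightarrow> int ^ 'n \<Rightarrow> int" where
  "tail A v z = int (card {j::nat. z + int j *s v \<in> A})"

lemma tail_facts:
  fixes q :: "int ^ 'n::finite"
  assumes v: "idot q v > 0" and A: "\<And>z. z \<in> A \<Longrightarrow> idot q z < C"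
  shows "tail A v z = ind A z + tail A v (z + v)"
    and "C \<le> idot q z \<Longrightarrow> tail A v z = 0"
    and "(\<And>z. z \<in> A \<Longrightarrow> - C < idot q z) \<Longrightarrow> tail A v z \<le> 2 * \<bar>C\<bar>"
proof -
  let ?J = "\<lambda>z. {j::nat. z + int j *s v \<in> A}"
  have lev: "idot q (z + int j *s v) = idot q z + int j * idot q v" for z j by (simp add: idot_simps)
  have ge: "int j \<le> int j * idot q v" for j using v mult_left_mono[of 1 "idot q v" "int j"] by simp
  have fin: "finite (?J z)" for z
  proof (rule finite_subset)
    show "?J z \<subseteq> {..nat (C - idot q z)}"
    proof
      fix j assume "j \<in> ?J z"
      hence "idot q z + int j * idot q v < C" using A[of "z + int j *s v"] lev[of z j] by simp
      thus "j \<in> {..nat (C - idot q z)}" using ge[of j] by simp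
    qed
  qed simp
  have "?J z = (if z \<in> A then {0} else {}) \<union> Suc ` ?J (z + v)"
  proof (rule set_eqI)
    fix j show "j \<in> ?J z \<longleftrightarrow> j \<in> (if z \<in> A then {0} else {}) \<union> Suc ` ?J (z + v)"
    proof (cases j)
      case (Suc k)
      have "z + int (Suc k) *s v = z + v + int k *s v" by (simp add: vec_eq_iff algebra_simps)
      hence "j \<in> ?J z \<longleftrightarrow> k \<in> ?J (z + v)" unfolding Suc mem_Collect_eq by (simp only:)
      thus ?thesis unfolding Suc by auto
    qed auto
  qed
  moreover have "(if z \<in> A then {0} else {}) \<inter> Suc ` ?J (z + v) = {}" by auto
  ultimately have "card (?J z) = card (if z \<in> A then {0::nat} else {}) + card (Suc ` ?J (z + v))"
    using fin by (simp add: card_Un_disjoint)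
  thus "tail A v z = ind A z + tail A v (z + v)"
    by (simp add: tail_def card_image)
  show "tail A v z = 0" if "C \<le> idot q z"
  proof -
    have "z + int j *s v \<notin> A" for j using A[of "z + int j *s v"] lev[of z j] ge[of j] that by auto
    thus ?thesis by (simp add: tail_def)
  qed
  show "tail A v z \<le> 2 * \<bar>C\<bar>" if B: "\<And>z. z \<in> A \<Longrightarrow> - C < idot q z"
  proof -
    have "card (?J z) \<le> card {- C<..<C}"
    proof (rule card_inj_on_le[of "\<lambda>j. idot q z + int j * idot q v"])
      show "inj_on (\<lambda>j. idot q z + int j * idot q v) (?J z)" using v by (auto simp: inj_on_def)
      show "(\<lambda>j. idot q z + int j * idot q v) ` ?J z \<subseteq> {- C<..<C}"
        using A B unfolding lev [symmetric] by auto
    qed simp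
    also have "\<dots> \<le> nat (2 * \<bar>C\<bar>)" by simp
    finally show ?thesis by (simp add: tail_def)
  qed
qed

text \<open>The difference of \<open>\<psi>\<close> and \<open>lap F\<close> is invariant under
  \<open>v\<close>, and far to the right it equals \<open>c\<close>.\<close>

lemma lap_eq_of_translation:
  fixes q :: "int ^ 'n::finite"
  assumes v: "idot q v > 0"
    and step: "\<And>z. lap F (z + v) - lap F z = \<psi> (z + v) - \<psi> z"
    and \<psi>: "\<And>z. C \<le> idot q z \<Longrightarrow> \<psi> z = c" and F: "\<And>z. C \<le> idot q z \<Longrightarrow> F z = 0"
  shows "\<psi> z = c + lap F z"
proof -
  have inv: "\<psi> (z + int n *s v) - lap F (z + int n *s v) = \<psi> z - lap F z" for n
  proof (induction n)
    case (Suc n)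
    have e: "z + int (Suc n) *s v = (z + int n *s v) + v" by (simp add: vec_eq_iff algebra_simps)
    show ?case unfolding e using Suc step[of "z + int n *s v"] by linarith
  qed simp
  define a where "a = (\<Sum>i\<in>UNIV. \<bar>q $ i\<bar>)"
  have a: "\<bar>q $ i\<bar> \<le> a" for i unfolding a_def by (rule member_le_sum) auto
  have a0: "a \<ge> 0" unfolding a_def by (rule sum_nonneg) auto
  define n where "n = nat (\<bar>C\<bar> + \<bar>idot q z\<bar> + a)"
  define y where "y = z + int n *s v"
  have "int n \<le> int n * idot q v" using v mult_left_mono[of 1 "idot q v" "int n"] by simp
  moreover have "int n = \<bar>C\<bar> + \<bar>idot q z\<bar> + a" using a0 by (simp add: n_def)
  ultimately have y: "C + a \<le> idot q y" unfolding y_def idot_add idot_scale by linarith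
  have "C \<le> idot q y + q $ i" "C \<le> idot q y - q $ i" for i using y a[of i] by linarith+
  hence "lap F y = lap (\<lambda>_. 0) y" 
    using y a0 by (intro lap_cong_near) (auto simp: F idot_simps)
  moreover have "\<psi> y = c" using y a0 by (intro \<psi>) simp
  ultimately show ?thesis using inv[of n] by (simp add: y_def lap_const)
qed

text \<open>If \<open>F\<close> gains exactly one unit per translation on the left, it agrees there with a global
  harmonic function, and periodicity makes that function affine.\<close>

lemma left_affine:
  fixes q :: "int ^ 'n::finite"
  assumes q: "primitive_vec q" and v: "idot q v > 0"
    and step: "\<And>z. idot q z \<le> - C \<Longrightarrow> F (z + v) = F z + 1"
    and harm: "\<And>z. idot q z \<le> - C \<Longrightarrow> lap F z = 0"
    and per: "\<And>w. idot q w = 0 \<Longrightarrow> \<exists>N>0. \<forall>z. F (z + N *s w) = F z"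
  obtains \<beta> where "idot q v = 1" "\<And>z. idot q z \<le> - C \<Longrightarrow> F z = idot q z + \<beta>"
proof -
  define r where "r = idot q v"
  have r: "r > 0" using v by (simp add: r_def)
  define k where "k z = nat (idot q z + C)" for z
  \<comment> \<open>Extends \<open>F\<close> from the left half-space to the whole lattice: go back
    far enough and add one unit per translation. By \<open>Hm\<close> any larger number of
    translations gives the same value.\<close>
  define H where "H z = F (z - int (k z) *s v) + int (k z)" for z
  have Hm: "F (z - int m *s v) + int m = H z" if "k z \<le> m" for z m
    using that
  proof (induction m rule: dec_induct)
    case base
    show ?case by (simp add: H_def)
  next
    case (step m)
    have "int (Suc m) \<le> int (Suc m) * r" using r mult_left_mono[of 1 r "int (Suc m)"] by simp
    moreover have "idot q z + C \<le> int (Suc m)" using step.hyps by (simp add: k_def)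
    ultimately have "idot q (z - int (Suc m) *s v) \<le> - C"
      unfolding idot_diff idot_scale r_def [symmetric] by linarith
    from assms(3)[OF this] have "F (z - int (Suc m) *s v + v) = F (z - int (Suc m) *s v) + 1" .
    moreover have "z - int (Suc m) *s v + v = z - int m *s v" by (simp add: vec_eq_iff algebra_simps)
    ultimately show ?case using step.IH by simp
  qed
  have HF: "H z = F z" if "idot q z \<le> - C" for z using that by (simp add: H_def k_def)
  define a where "a = (\<Sum>i\<in>UNIV. \<bar>q $ i\<bar>)"
  have a: "\<bar>q $ i\<bar> \<le> a" for i unfolding a_def by (rule member_le_sum) auto
  have a0: "a \<ge> 0" unfolding a_def by (rule sum_nonneg) auto
  have Hharm: "lap H z = 0" for z
  proof -
    define m where "m = k z + nat a"
    have "k (z + axis i 1) \<le> m" "k (z - axis i 1) \<le> m" "k z \<le> m" for i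
      using a[of i] by (auto simp: m_def k_def idot_simps nat_le_iff)
    hence "lap H z = lap (\<lambda>z. F (z - int m *s v) + int m) z"
      by (intro lap_cong_near Hm [symmetric])
    also have "\<dots> = lap F (z - int m *s v)" by (simp add: lap_add lap_const lap_shift_diff)
    also have "\<dots> = 0"
    proof (rule harm)
      have "int m \<le> int m * r" using r mult_left_mono[of 1 r "int m"] by simp
      moreover have "idot q z + C \<le> int m" by (simp add: m_def k_def)
      ultimately show "idot q (z - int m *s v) \<le> - C"
        unfolding idot_diff idot_scale r_def [symmetric] by linarith
    qed
    finally show ?thesis .
  qed
  \<comment> \<open>Along \<open>v\<close> both terms grow by \<open>r\<close>, so this harmonic
    function has the period \<open>v\<close>.\<close>
  define B where "B z = r * H z - idot q z" for z
  define P where "P = {p. \<forall>z. B (z + p) = B z}"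
  have P: "sublattice P" unfolding sublattice_def P_def
  proof (intro conjI ballI; clarsimp)
    fix x y z assume "\<forall>z. B (z + x) = B z" "\<forall>z. B (z + y) = B z"
    thus "B (z + (x - y)) = B z" by (metis add_diff_eq diff_add_cancel add.commute)
  qed
  have vP: "v \<in> P"
  proof -
    have "H (z + v) = H z + 1" for z
    proof -
      define m where "m = k z + k (z + v)"
      have e: "z + v - int (Suc m) *s v = z - int m *s v" by (simp add: vec_eq_iff algebra_simps)
      have "k (z + v) \<le> Suc m" "k z \<le> m" by (simp_all add: m_def)
      thus ?thesis using Hm[of "z + v" "Suc m"] Hm[of z m] unfolding e by linarith
    qed
    thus ?thesis by (simp add: P_def B_def idot_add r_def algebra_simps)
  qed
  have perP: "\<exists>N>0. N *s w \<in> P" if w: "idot q w = 0" for w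
  proof -
    obtain N where N: "N > 0" "\<And>z. F (z + N *s w) = F z" using per[OF w] by blast
    have "H (z + N *s w) = H z" for z
    proof -
      have "k (z + N *s w) = k z" by (simp add: k_def idot_simps w)
      moreover have "z + N *s w - int (k z) *s v = (z - int (k z) *s v) + N *s w" by simp
      ultimately show ?thesis unfolding H_def by (simp only: N(2))
    qed
    thus ?thesis using N(1) by (intro exI[of _ N]) (simp add: P_def B_def idot_simps w)
  qed
  have "\<exists>N>0. axis i N \<in> P" for i
  proof -
    \<comment> \<open>A vector of level zero. A multiple of it is a period, and adding a multiple of
      \<open>v\<close> leaves a period on the axis \<open>i\<close>; periods on all axes make
      \<open>B\<close> bounded, hence constant.\<close>
    define w where "w = axis i r - (q $ i) *s v"
    have "idot q w = 0" by (simp add: w_def idot_simps r_def)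
    then obtain N where N: "N > 0" "N *s w \<in> P" using perP by blast
    have "(\<Sum>b\<in>UNIV. (if b then 1 else N * q $ i) *s (if b then N *s w else v)) \<in> P"
      by (rule sublattice_sum[OF P]) (use N vP in auto)
    also have "(\<Sum>b\<in>UNIV. (if b then 1 else N * q $ i) *s (if b then N *s w else v)) = axis i (N * r)"
      by (simp add: UNIV_bool w_def vec_eq_iff axis_def algebra_simps)
    finally show ?thesis using N(1) r by (intro exI[of _ "N * r"]) auto
  qed
  then obtain N where N: "\<And>i. N i > 0" "\<And>i. axis i (N i) \<in> P" by metis
  let ?box = "{x :: int ^ 'n. \<forall>i. x $ i \<in> {0..(\<Sum>i\<in>UNIV. N i)}}"
  have "\<exists>x\<in>?box. B z = B x" for z
  proof
    define p where "p = (\<Sum>i\<in>UNIV. (- (z $ i div N i)) *s axis i (N i))"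
    have "p \<in> P" unfolding p_def by (rule sublattice_sum[OF P]) (use N in auto)
    thus "B z = B (z + p)" by (simp add: P_def)
    have "p $ i = - (z $ i div N i) * N i" for i
    proof -
      have "p $ i = (\<Sum>j\<in>UNIV. (- (z $ j div N j)) * axis j (N j) $ i)" by (simp add: p_def)
      also have "\<dots> = (\<Sum>j\<in>UNIV. if j = i then - (z $ i div N i) * N i else 0)"
        by (rule sum.cong) (auto simp: axis_def)
      finally show ?thesis by simp
    qed
    hence "(z + p) $ i = z $ i mod N i" for i by (simp add: minus_div_mult_eq_mod)
    moreover have "z $ i mod N i \<le> (\<Sum>i\<in>UNIV. N i)" for i
    proof -
      have "N i \<le> (\<Sum>i\<in>UNIV. N i)" by (rule member_le_sum) (use N(1) less_imp_le in auto)
      thus ?thesis using pos_mod_bound[OF N(1)[of i], of "z $ i"] by linarith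
    qed
    ultimately show "z + p \<in> ?box" using N(1) by auto
  qed
  moreover have "finite (B ` ?box)" by (intro finite_imageI finite_box) simp
  ultimately have lb: "Min (B ` ?box) \<le> B z" for z by (metis (no_types, lifting) Min_le imageI)
  have "superharmonic B"
    unfolding superharmonic_def B_def by (simp add: lap_diff lap_cmult lap_idot Hharm)
  hence Bc: "B z = B 0" for z using superharmonic_bdd_below_const lb by blast
  obtain x where x: "\<And>t. idot q (t *s x) = t" using primitive_idot[OF q] by blast
  \<comment> \<open>\<open>B\<close> is constant and \<open>x\<close> climbs one level, so the
    positive integer \<open>r\<close> divides \<open>1\<close>.\<close>
  have "r * (H (1 *s x) - H (0 *s x)) = 1"
    using Bc[of "1 *s x"] Bc[of "0 *s x"] unfolding B_def x by (simp add: algebra_simps)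
  hence "r = 1" using r by (metis dvd_triv_left zdvd1_eq abs_of_pos)
  moreover from this have "F z = idot q z + B 0" if "idot q z \<le> - C" for z
    using Bc[of z] HF[OF that] by (simp add: B_def)
  ultimately show ?thesis using that by (simp add: r_def)
qed

lemma finite_level_bound:
  assumes "hyperplane_shaped q (\<psi> :: 'n::finite config)"
  obtains C where "0 \<le> C" "\<forall>z. C \<le> \<bar>idot q z\<bar> \<longrightarrow> \<psi> z = 2 * int CARD('n) - 1"
proof -
  obtain c1 c2 :: real where c: "{z. \<psi> z \<noteq> 2 * int CARD('n) - 1} \<subseteq> {z. c1 \<le> idot q z \<and> idot q z \<le> c2}"
    using assms by (auto simp: hyperplane_shaped_def)
  define C where "C = \<lceil>\<bar>c1\<bar> + \<bar>c2\<bar>\<rceil> + 1"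
  have C: "\<bar>c1\<bar> + \<bar>c2\<bar> < C" unfolding C_def by linarith
  show ?thesis
  proof (rule that)
    show "0 \<le> C" using C by linarith
    show "\<forall>z. C \<le> \<bar>idot q z\<bar> \<longrightarrow> \<psi> z = 2 * int CARD('n) - 1"
    proof (intro allI impI, rule ccontr)
      fix z assume z: "C \<le> \<bar>idot q z\<bar>" and "\<psi> z \<noteq> 2 * int CARD('n) - 1"
      hence "c1 \<le> idot q z" "idot q z \<le> c2" using c by auto
      moreover have "real_of_int C \<le> \<bar>real_of_int (idot q z)\<bar>" using z by linarith
      ultimately show False using C by linarith
    qed
  qed
qed

text \<open>The wave topples the left half-space and spares the right one, since any other behaviour
  yields a superharmonic function bounded below, hence constant. Therefore the wave indicators can
  be summed along \<open>v\<close> to a potential \<open>F\<close> of \<open>\<psi>\<close>.\<close>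

lemma soliton_unique_oriented:
  fixes q :: "int ^ 'n::finite"
  assumes q: "primitive_vec q" and lp: "least_potential q \<theta>"
    and L: "sublattice L" "lattice_rank L = CARD('n) - 1" "periodic_wrt L \<psi>"
    and mov: "movable_by v \<psi>" and hyp: "hyperplane_shaped q \<psi>" and qv: "0 \<le> idot q v"
  obtains t where "\<And>z. \<psi> z = 2 * int CARD('n) - 1 + lap \<theta> (z + t)"
proof -
  let ?c = "2 * int CARD('n) - 1"
  obtain C where C: "0 \<le> C" "\<forall>z. C \<le> \<bar>idot q z\<bar> \<longrightarrow> \<psi> z = ?c" using finite_level_bound[OF hyp] by blast
  obtain z0 where w: "wave z0 \<psi> (\<lambda>z. \<psi> (z + v))" and "\<not> (\<forall>z. \<psi> z = \<psi> (z + v))"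
    using mov unfolding movable_by_def by blast
  then obtain zn where zn: "\<psi> (zn + v) \<noteq> \<psi> zn" by metis
  have z0: "\<psi> z0 = ?c" and rel: "relaxes_to (topple z0 \<psi>) (\<lambda>z. \<psi> (z + v))" using w by (auto simp: wave_def)
  have "\<psi> (z - v + v) < 2 * int CARD('n)" for z using rel unfolding relaxes_to_def by blast
  hence stable: "\<psi> z < 2 * int CARD('n)" for z by simp
  obtain T where T: "z0 \<in> T" "\<forall>z. \<psi> (z + v) = \<psi> z + lap (ind T) z"
    and least: "\<forall>u. (\<forall>z. 0 \<le> u z) \<longrightarrow> 1 \<le> u z0 \<longrightarrow> (\<forall>z. \<psi> z + lap u z < 2 * int CARD('n))
      \<longrightarrow> (\<forall>z. ind T z \<le> u z)"
    by (rule wave_least[OF rel stable])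
  have lapT: "lap (ind T) z = \<psi> (z + v) - \<psi> z" for z using T(2) by simp
  have Tst: "\<psi> z + lap (ind T) z < 2 * int CARD('n)" for z using stable[of "z + v"] T(2) by simp
  have notall: "T \<noteq> UNIV" using zn lapT[of zn] by (auto simp: lap_const)
  have left: "x \<in> T \<longleftrightarrow> y \<in> T" if "idot q x \<le> - C" "idot q y \<le> - C" for x y
    by (rule wave_all_or_none[OF Tst _ that]) (use C in auto)
  have right: "x \<in> T \<longleftrightarrow> y \<in> T" if "C \<le> idot q x" "C \<le> idot q y" for x y
    by (rule wave_all_or_none[OF Tst, of "- q" "- C"]) (use C that in \<open>auto simp: idot_uminus_left\<close>)
  obtain x where x: "\<And>t. idot q (t *s x) = t" using primitive_idot[OF q] by blast
  have nT: "\<exists>z. \<psi> z \<noteq> ?c" using zn by metis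
  \<comment> \<open>A period off the hyperplane would carry a site that is not full out of the
    strip.\<close>
  have orth: "idot q p = 0" if p: "p \<in> L" for p
  proof (rule ccontr)
    assume "idot q p \<noteq> 0"
    obtain z where z: "\<psi> z \<noteq> ?c" using nT by blast
    have inv: "\<psi> (z + int n *s p) = \<psi> z" for n
    proof (induction n)
      case (Suc n)
      have "z + int (Suc n) *s p = (z + int n *s p) + p" by (simp add: vec_eq_iff algebra_simps)
      thus ?case using Suc L(3) p unfolding periodic_wrt_def by metis
    qed simp
    define n where "n = nat (C + \<bar>idot q z\<bar>)"
    have "int n \<le> int n * \<bar>idot q p\<bar>" using \<open>idot q p \<noteq> 0\<close> mult_left_mono[of 1 "\<bar>idot q p\<bar>" "int n"] by simp
    hence "C + \<bar>idot q z\<bar> \<le> \<bar>int n * idot q p\<bar>" using C(1) by (simp add: n_def abs_mult)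
    hence "C \<le> \<bar>idot q (z + int n *s p)\<bar>" unfolding idot_add idot_scale by linarith
    thus False using C(2) inv z by metis
  qed
  have mult: "\<exists>N>0. N *s w \<in> L" if "idot q w = 0" for w
    using multiple_in_full_rank_sublattice[OF L(1,2) primitive_nonzero[OF q] orth that] by blast
  have "idot q v \<noteq> 0"
  proof
    assume v0: "idot q v = 0"
    obtain N where N: "N > 0" "N *s v \<in> L" using mult[OF v0] by blast
    \<comment> \<open>The sum of the waves over one period \<open>N *s v\<close> is harmonic and
      nonnegative, hence constant. On the level \<open>- C\<close>, which \<open>v\<close>
      preserves, either all sites or none topple, so the constant is \<open>n\<close> or
      \<open>0\<close>: then \<open>T\<close> is everything or misses \<open>z0\<close>.\<close>
    define S where "S n z = (\<Sum>j<n. ind T (z + int j *s v))" for n z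
    have lapS: "lap (S n) z = \<psi> (z + int n *s v) - \<psi> z" for n z
    proof (induction n)
      case 0
      show ?case by (simp add: S_def lap_const)
    next
      case (Suc n)
      have "S (Suc n) = (\<lambda>z. S n z + ind T (z + int n *s v))" by (simp add: S_def fun_eq_iff)
      hence "lap (S (Suc n)) z = lap (S n) z + lap (\<lambda>z. ind T (z + int n *s v)) z" by (simp only: lap_add)
      also have "lap (\<lambda>z. ind T (z + int n *s v)) z = lap (ind T) (z + int n *s v)" by (rule lap_shift)
      also have "\<dots> = \<psi> (z + int n *s v + v) - \<psi> (z + int n *s v)" by (rule lapT)
      also have "z + int n *s v + v = z + int (Suc n) *s v" by (simp add: vec_eq_iff algebra_simps)
      finally show ?case using Suc by simp
    qed
    define n where "n = nat N"
    have "int n = N" using N(1) by (simp add: n_def)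
    moreover have "\<psi> (z + N *s v) = \<psi> z" for z
      using L(3) N(2) unfolding periodic_wrt_def by metis
    ultimately have "\<psi> (z + int n *s v) = \<psi> z" for z by simp
    hence "superharmonic (S n)" by (simp add: superharmonic_def lapS)
    moreover have "0 \<le> S n z" for z by (simp add: S_def sum_nonneg)
    ultimately have const: "S n z = S n y" for z y by (rule superharmonic_bdd_below_const)
    define y where "y = (- C) *s x"
    have qy: "idot q (y + int j *s v) = - C" for j unfolding y_def idot_add idot_scale v0 using x[of "- C"]
      by (simp add: idot_scale)
    have yT: "y + int j *s v \<in> T \<longleftrightarrow> y \<in> T" for j using left[of "y + int j *s v" y] qy[of j] qy[of 0] by simp
    have n0: "0 < n" using N(1) by (simp add: n_def)
    show False
    proof (cases "y \<in> T")
      case True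
      hence "S n y = int n" by (simp add: S_def yT)
      have "z \<in> T" for z
      proof (rule ccontr)
        assume "z \<notin> T"
        have "S n z < (\<Sum>j<n. 1)" unfolding S_def
          by (rule sum_strict_mono_ex1) (use n0 \<open>z \<notin> T\<close> in \<open>auto intro!: bexI[of _ 0]\<close>)
        thus False using const[of z y] \<open>S n y = int n\<close> by simp
      qed
      thus False using notall by auto
    next
      case False
      hence "S n y = 0" by (simp add: S_def yT)
      moreover have "ind T (z0 + int 0 *s v) \<le> S n z0" unfolding S_def
        by (rule member_le_sum) (use n0 in auto)
      ultimately show False using const[of z0 y] T(1) by simp
    qed
  qed
  hence v: "idot q v > 0" using qv by simp
  define y where "y = C *s x"
  have qy: "idot q y = C" by (simp add: y_def x)
  \<comment> \<open>Otherwise the tails of the complement of \<open>T\<close> give a nonnegative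
    superharmonic function, which is constant and thus \<open>0\<close>. Then every site topples and
    the wave moves nothing.\<close>
  have yT: "y \<notin> T"
  proof
    assume "y \<in> T"
    hence A: "idot q z < C" if "z \<in> - T" for z using right[of z y] qy that by (cases "C \<le> idot q z") auto
    define F where "F = tail (- T) v"
    have F: "F z = ind (- T) z + F (z + v)" "C \<le> idot q z \<Longrightarrow> F z = 0" for z
      unfolding F_def using tail_facts(1,2)[OF v A] by blast+
    have Feq: "F (z + v) = F z + ind T z - 1" for z using F(1)[of z] by simp
    have "\<psi> z = ?c + lap F z" for z
    proof (rule lap_eq_of_translation[OF v, of F \<psi> C])
      fix z
      have "lap F (z + v) = lap (\<lambda>z. F z + ind T z - 1) z" by (simp only: lap_shift [symmetric] Feq)
      also have "\<dots> = lap F z + lap (ind T) z" by (simp only: lap_diff lap_add lap_const)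
      finally show "lap F (z + v) - lap F z = \<psi> (z + v) - \<psi> z" by (simp add: lapT)
      show "\<psi> z = ?c" if "C \<le> idot q z" using C(2) that by simp
      show "F z = 0" if "C \<le> idot q z" by (rule F(2)[OF that])
    qed
    hence "superharmonic F" unfolding superharmonic_def using stable by (smt (verit))
    moreover have "0 \<le> F z" for z by (simp add: F_def tail_def)
    ultimately have "F z = F y" for z by (rule superharmonic_bdd_below_const)
    hence "F z = 0" for z using F(2)[of y] qy by simp
    hence "z \<in> T" for z using F(1)[of z] by (cases "z \<in> T") auto
    thus False using notall by auto
  qed
  hence A: "idot q z < C" if "z \<in> T" for z using right[of z y] qy that by (cases "C \<le> idot q z") auto
  define F where "F z = - tail T v z" for z
  have Fv: "F (z + v) = F z + ind T z" and FC: "C \<le> idot q z \<Longrightarrow> F z = 0" for z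
    unfolding F_def using tail_facts(1,2)[OF v A, where z = z] by simp_all
  have \<psi>F: "\<psi> z = ?c + lap F z" for z
  proof (rule lap_eq_of_translation[OF v, of F \<psi> C])
    fix z
    have "lap F (z + v) = lap (\<lambda>z. F z + ind T z) z" by (simp only: lap_shift [symmetric] Fv)
    also have "\<dots> = lap F z + lap (ind T) z" by (simp only: lap_add)
    finally show "lap F (z + v) - lap F z = \<psi> (z + v) - \<psi> z" by (simp add: lapT)
    show "\<psi> z = ?c" if "C \<le> idot q z" using C(2) that by simp
    show "F z = 0" if "C \<le> idot q z" by (rule FC[OF that])
  qed
  have sF: "superharmonic F" unfolding superharmonic_def using stable \<psi>F by (smt (verit))
  \<comment> \<open>A wave sparing the left half-space would be confined to the strip. Then
    \<open>F\<close> would be bounded below, hence constant and zero, although \<open>z0\<close>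
    topples.\<close>
  have leftT: "z \<in> T" if z: "idot q z \<le> - C" for z
  proof (rule ccontr)
    assume "z \<notin> T"
    hence B: "- C < idot q x" if "x \<in> T" for x using left[of x z] z that by (cases "idot q x \<le> - C") auto
    have "- (2 * \<bar>C\<bar>) \<le> F u" for u unfolding F_def using tail_facts(3)[OF v A B, where z = u] by simp
    hence "F u = F y" for u by (rule superharmonic_bdd_below_const[OF sF])
    hence "F u = 0" for u using FC[of y] qy by simp
    thus False using Fv[of z0] T(1) by simp
  qed
  \<comment> \<open>The wave inherits the periods of \<open>\<psi>\<close>: the change of its
    indicator under a period is harmonic and bounded, hence constant, and it vanishes in the left
    half-space.\<close>
  have perF: "F (z + p) = F z" if p: "p \<in> L" for z p
  proof -
    define \<delta> where "\<delta> z = ind T (z + p) - ind T z" for z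
    have "lap \<delta> z = 0" for z
    proof -
      have "lap \<delta> z = lap (\<lambda>z. ind T (z + p)) z - lap (ind T) z" unfolding \<delta>_def by (rule lap_diff)
      also have "lap (\<lambda>z. ind T (z + p)) z = lap (ind T) (z + p)" by (rule lap_shift)
      finally have "lap \<delta> z = \<psi> (z + p + v) - \<psi> (z + p) - (\<psi> (z + v) - \<psi> z)" by (simp only: lapT)
      moreover have "z + p + v = z + v + p" by simp
      ultimately show ?thesis using L(3) p unfolding periodic_wrt_def by (smt (verit))
    qed
    hence "superharmonic \<delta>" by (simp add: superharmonic_def)
    moreover have "- 1 \<le> \<delta> z" for z by (simp add: \<delta>_def)
    ultimately have "\<delta> z = \<delta> ((- C) *s x)" for z by (rule superharmonic_bdd_below_const)
    moreover have "\<delta> ((- C) *s x) = 0"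
    proof -
      have "(- C) *s x \<in> T" "(- C) *s x + p \<in> T"
        by (rule leftT; simp only: idot_add x orth[OF p]; simp)+
      thus ?thesis by (simp add: \<delta>_def)
    qed
    ultimately have "ind T (z + p) = ind T z" for z unfolding \<delta>_def by (metis eq_iff_diff_eq_0)
    hence "z + p \<in> T \<longleftrightarrow> z \<in> T" for z by (metis of_bool_eq_iff)
    hence "z + p + int j *s v \<in> T \<longleftrightarrow> z + int j *s v \<in> T" for j by (metis add.commute add.left_commute)
    thus ?thesis by (simp add: F_def tail_def)
  qed
  have per: "\<exists>N>0. \<forall>z. F (z + N *s w) = F z" if "idot q w = 0" for w
    using mult[OF that] perF by blast
  obtain \<beta> where v1: "idot q v = 1" and \<beta>: "\<And>z. idot q z \<le> - C \<Longrightarrow> F z = idot q z + \<beta>"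
  proof (rule left_affine[OF q v, of C F])
    show "F (z + v) = F z + 1" if "idot q z \<le> - C" for z using leftT[OF that] Fv by simp
    show "lap F z = 0" if "idot q z \<le> - C" for z using \<psi>F[of z] C that by simp
  qed (use per that in blast)+
  \<comment> \<open>Translating by \<open>\<beta> *s v\<close> turns the left branch
    \<open>idot q z + \<beta>\<close> into \<open>idot q z\<close>; the strip widens by
    \<open>\<bar>\<beta>\<bar>\<close> and the origin moves along.\<close>
  have "F (z - \<beta> *s v) = \<theta> z" for z
  proof (rule moving_potential_unique[OF lp primitive_nonzero[OF q] v1, where F = "\<lambda>z. F (z - \<beta> *s v)" and C = "C + \<bar>\<beta>\<bar>" and ?z0.0 = "z0 + \<beta> *s v"])
    have s: "z + v - \<beta> *s v = z - \<beta> *s v + v" for z by simp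
    show "superharmonic (\<lambda>z. F (z - \<beta> *s v))" by (rule superharmonic_shift_diff[OF sF])
    show "F (z - \<beta> *s v) = min 0 (idot q z)" if "C + \<bar>\<beta>\<bar> \<le> \<bar>idot q z\<bar>" for z
    proof -
      have i: "idot q (z - \<beta> *s v) = idot q z - \<beta>" unfolding idot_diff idot_scale v1 by simp
      show ?thesis
      proof (cases "idot q z \<le> 0")
        case True
        thus ?thesis using \<beta>[of "z - \<beta> *s v"] C(1) that unfolding i by linarith
      next
        case False
        thus ?thesis using FC[of "z - \<beta> *s v"] C(1) that unfolding i by linarith
      qed
    qed
    show "F (z - \<beta> *s v) \<le> F (z + v - \<beta> *s v) \<and> F (z + v - \<beta> *s v) \<le> F (z - \<beta> *s v) + 1" for z
      unfolding s Fv by simp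
    show "lap (\<lambda>z. F (z - \<beta> *s v)) (z0 + \<beta> *s v) = 0"
      using \<psi>F[of z0] z0 by (simp add: lap_shift_diff)
    show "\<exists>N>0. \<forall>z. F (z + N *s w - \<beta> *s v) = F (z - \<beta> *s v)" if qw: "idot q w = 0" for w
    proof -
      obtain N where N: "N > 0" "\<And>z. F (z + N *s w) = F z" using per[OF qw] by blast
      have "z + N *s w - \<beta> *s v = z - \<beta> *s v + N *s w" for z by simp
      thus ?thesis using N by (intro exI[of _ N]) (simp only: simp_thms)
    qed
    fix F' z assume F': "superharmonic F'" "\<And>y. F (y - \<beta> *s v) \<le> F' y"
      "F (z0 + \<beta> *s v - \<beta> *s v) < F' (z0 + \<beta> *s v)"
    \<comment> \<open>A superharmonic majorant of the potential differs from it by a competitor of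
      the wave.\<close>
    define u where "u y = F' (y + \<beta> *s v) - F y" for y
    have "0 \<le> u y" for y using F'(2)[of "y + \<beta> *s v"] by (simp add: u_def)
    moreover have "1 \<le> u z0" using F'(3) by (simp add: u_def)
    moreover have "\<psi> y + lap u y < 2 * int CARD('n)" for y
    proof -
      have "lap u y = lap F' (y + \<beta> *s v) - lap F y" unfolding u_def by (simp only: lap_diff lap_shift)
      thus ?thesis using F'(1) \<psi>F[of y] unfolding superharmonic_def by (smt (verit))
    qed
    ultimately have "ind T (z - \<beta> *s v) \<le> u (z - \<beta> *s v)" using least by blast
    thus "F (z + v - \<beta> *s v) \<le> F' z" unfolding s Fv by (simp add: u_def)
  qed
  hence Fz: "F z = \<theta> (z + \<beta> *s v)" for z by (metis add_diff_cancel_right')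
  have "\<psi> z = ?c + lap \<theta> (z + \<beta> *s v)" for z
  proof -
    have "F = (\<lambda>z. \<theta> (z + \<beta> *s v))" by (rule ext) (rule Fz)
    hence "lap F z = lap \<theta> (z + \<beta> *s v)" by (simp only: lap_shift)
    thus ?thesis using \<psi>F[of z] by (simp only:)
  qed
  thus ?thesis by (rule that)
qed

theorem theorem1:
  fixes q :: "int ^ 'n::finite"
  assumes "primitive_vec q"
  shows "\<exists>\<phi>. soliton q \<phi> \<and>
           (\<forall>\<psi>. soliton q \<psi> \<longrightarrow> (\<exists>t. \<forall>z. \<psi> z = \<phi> (z + t))) \<and>
           (\<forall>v. idot q v = 1 \<longrightarrow> movable_by v \<phi>)"
proof -
  obtain \<theta> where lp: "least_potential q \<theta>" using least_potential_exists[OF assms] by blast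
  let ?\<phi> = "\<lambda>z. 2 * int CARD('n) - 1 + lap \<theta> z"
  have "\<exists>t. \<forall>z. \<psi> z = ?\<phi> (z + t)" if \<psi>: "soliton q \<psi>" for \<psi>
  proof -
    obtain L where L: "sublattice L" "lattice_rank L = CARD('n) - 1" "periodic_wrt L \<psi>"
      using \<psi> by (auto simp: soliton_def periodic_def)
    obtain v where v: "movable_by v \<psi>" using \<psi> by (auto simp: soliton_def movable_def)
    have h: "hyperplane_shaped q \<psi>" using \<psi> by (simp add: soliton_def)
    show ?thesis
    proof (cases "0 \<le> idot q v")
      case True
      show ?thesis using soliton_unique_oriented[OF assms lp L v h True] by metis
    next
      case False
      \<comment> \<open>A backward motion for \<open>q\<close> is a forward one for
        \<open>- q\<close>, and the reflected potential gives the same state.\<close>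
      have q': "primitive_vec (- q)" unfolding primitive_vec_def
      proof
        assume "\<exists>k q'. k > 1 \<and> - q = k *s q'"
        then obtain k q' where k: "k > 1" "- q = k *s q'" by blast
        have "q = - (- q)" by simp
        also have "\<dots> = k *s (- q')" unfolding k(2) by (simp add: vec_eq_iff)
        finally show False using assms k(1) unfolding primitive_vec_def by blast
      qed
      have h': "hyperplane_shaped (- q) \<psi>"
      proof -
        obtain c1 c2 :: real where "{z. \<psi> z \<noteq> 2 * int CARD('n) - 1} \<subseteq> {z. c1 \<le> idot q z \<and> idot q z \<le> c2}"
          using h by (auto simp: hyperplane_shaped_def)
        hence "{z. \<psi> z \<noteq> 2 * int CARD('n) - 1} \<subseteq> {z. - c2 \<le> idot (- q) z \<and> idot (- q) z \<le> - c1}"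
          by (auto simp: idot_uminus_left)
        thus ?thesis unfolding hyperplane_shaped_def by blast
      qed
      obtain t where "\<And>z. \<psi> z = 2 * int CARD('n) - 1 + lap (\<lambda>z. \<theta> z - idot q z) (z + t)"
        using soliton_unique_oriented[OF q' lp_reflect[OF lp] L v h'] False by (auto simp: idot_uminus_left)
      thus ?thesis by (auto simp: lap_diff lap_idot)
    qed
  qed
  thus ?thesis using lp_soliton[OF assms lp] lp_movable[OF lp] by blast
qed

end
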